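(* For any pair of positive integers $k,n$ with $n \geq k+2$, we have \[ \frac{1}{2}\log(n-k+1) \leq \mathrm{sinv}'_k(n) \leq \log n + 4k - 3 . \]
   Context: All logarithms are to base 2. A digraph has no loops and no parallel arcs but may contain digons (pairs of opposite arcs between the same two vertices). For a digraph $D$ and $X \subseteq V(D)$, inverting $X$ means reversing the direction of every arc of $D$ with both endvertices in $X$; for a family $(X_i)_{i\in I}$ of vertex subsets, $\mathrm{Inv}(D;(X_i)_{i\in I})$ denotes the digraph obtained by inverting the $X_i$ one after another (equivalently, reversing exactly those arcs whose two endvertices lie together in an odd number of the $X_i$). A digraph $D$ is $k$-arc-strong if for every partition $(V_1,V_2)$ of $V(D)$ into nonempty sets there are at least $k$ arcs with tail in $V_1$ and head in $V_2$. $\mathrm{sinv}'_k(D)$ is the minimum number of sets whose inversion transforms $D$ into a $k$-arc-strong digraph. A digraph is $2k$-edge-connected if its underlying undirected multigraph (obtained by forgetting arc orientations, so a digon yields two parallel edges) is $2k$-edge-connected. $\mathrm{sinv}'_k(n) = \max\{\mathrm{sinv}'_k(D) : D \text{ is a } 2k\text{-edge-connected digraph of order } n\}$. *)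

theory Defs
  imports Complex_Main "HOL-Library.Extended_Nat"
begin

text \<open>A digraph of order n: vertex set {..<n}, arc set A (no loops; no parallel arcs
  since A is a set of ordered pairs; digons allowed).\<close>
definition digraph_on :: "nat \<Rightarrow> (nat \<times> nat) set \<Rightarrow> bool" where
  "digraph_on n A \<longleftrightarrow> A \<subseteq> {..<n} \<times> {..<n} \<and> (\<forall>v. (v, v) \<notin> A)"

definition invert :: "nat set \<Rightarrow> (nat \<times> nat) set \<Rightarrow> (nat \<times> nat) set" where
  "invert X A = {(u, v) \<in> A. \<not> (u \<in> X \<and> v \<in> X)} \<union>
                {(v, u) | u v. (u, v) \<in> A \<and> u \<in> X \<and> v \<in> X}"

definition Inv :: "(nat \<times> nat) set \<Rightarrow> nat set list \<Rightarrow> (nat \<times> nat) set" where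
  "Inv A Xs = fold invert Xs A"

definition arcs_from_to :: "(nat \<times> nat) set \<Rightarrow> nat set \<Rightarrow> nat set \<Rightarrow> nat" where
  "arcs_from_to A V1 V2 = card {(u, v) \<in> A. u \<in> V1 \<and> v \<in> V2}"

definition k_arc_strong :: "nat \<Rightarrow> nat \<Rightarrow> (nat \<times> nat) set \<Rightarrow> bool" where
  "k_arc_strong k n A \<longleftrightarrow>
     (\<forall>V1 V2. V1 \<inter> V2 = {} \<and> V1 \<union> V2 = {..<n} \<and> V1 \<noteq> {} \<and> V2 \<noteq> {}
        \<longrightarrow> arcs_from_to A V1 V2 \<ge> k)"

text \<open>Underlying multigraph is m-edge-connected: every edge cut has at least m edges
  (a digon contributes two parallel edges).\<close>
definition edge_connected :: "nat \<Rightarrow> nat \<Rightarrow> (nat \<times> nat) set \<Rightarrow> bool" where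
  "edge_connected m n A \<longleftrightarrow>
     (\<forall>V1 V2. V1 \<inter> V2 = {} \<and> V1 \<union> V2 = {..<n} \<and> V1 \<noteq> {} \<and> V2 \<noteq> {}
        \<longrightarrow> arcs_from_to A V1 V2 + arcs_from_to A V2 V1 \<ge> m)"

text \<open>sinv'_k(D) (infinite if no family of inversions works).\<close>
definition sinv_digraph :: "nat \<Rightarrow> nat \<Rightarrow> (nat \<times> nat) set \<Rightarrow> enat" where
  "sinv_digraph k n A = Inf {enat (length Xs) | Xs.
       (\<forall>X \<in> set Xs. X \<subseteq> {..<n}) \<and> k_arc_strong k n (Inv A Xs)}"

definition sinv_order :: "nat \<Rightarrow> nat \<Rightarrow> enat" where
  "sinv_order k n = Sup {sinv_digraph k n A | A.
       digraph_on n A \<and> edge_connected (2 * k) n A}"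

end

theory Submission
  imports Defs "HOL-Library.Product_Lexorder"
begin

text \<open>
  For the upper bound, first fix a target orientation. Removing redundant edges and splitting off
  vertices of degree \<open>2k\<close> (Mader, Lovasz) yields a multigraph \<open>M\<close> such that adding \<open>M\<close> to the
  underlying graph makes all degrees even, while every cut still exceeds its \<open>M\<close>-part by \<open>2k\<close>. An
  Eulerian orientation of the sum, restricted to the digraph, is \<open>k\<close>-arc-strong; digons contribute
  nothing to parity and need no reversal.

  A family of \<open>t\<close> inversions is the same as a map \<open>g\<close> from vertices to vectors over the field with
  two elements of dimension \<open>t\<close>: the pair \<open>uv\<close> is flipped iff the scalar product of \<open>g u\<close> and
  \<open>g v\<close> is 1. Only a minimal \<open>2k\<close>-edge-connected subgraph matters. There, order the vertices by
  decreasing size of the least tight set \<open>Z x\<close> containing \<open>x\<close> and avoiding a fixed root. Then all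
  earlier neighbours of \<open>x\<close> are reached through the tight cut of \<open>Z x\<close>, so there are at most \<open>2k\<close> of
  them, and the vectors can be chosen greedily such that the vectors of the earlier neighbours of
  every vertex stay linearly independent: the prescribed scalar products then leave \<open>2 ^ (t - d)\<close>
  candidates for a vertex with \<open>d\<close> earlier neighbours, more than the candidates excluded by the
  independence requirements.

  For the lower bound, take \<open>m\<close> hubs, \<open>k - 1\<close> vertices joined to everything by digons, and for each
  pair of hubs a sink with these two hubs as its only other in-neighbours. A \<open>k\<close>-arc-strong inversion
  must flip exactly one of the two hub arcs at each sink, so the vectors of the hubs are distinct and
  \<open>m \<le> 2 ^ t\<close>.
\<close>

section \<open>Cuts in multigraphs\<close>

text \<open>Multiplicity functions make adding and removing edges pointwise arithmetic. As they
  vanish off \<open>V\<close>, the same function can be read on a larger vertex set, for instance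
  when a split-off vertex is put back.\<close>

definition mgraph :: "'a set \<Rightarrow> ('a \<Rightarrow> 'a \<Rightarrow> nat) \<Rightarrow> bool" where
  "mgraph V e \<longleftrightarrow> finite V \<and> (\<forall>u v. e u v = e v u) \<and> (\<forall>u. e u u = 0) \<and> (\<forall>u v. u \<notin> V \<longrightarrow> e u v = 0)"

definition cut_size :: "'a set \<Rightarrow> ('a \<Rightarrow> 'a \<Rightarrow> nat) \<Rightarrow> 'a set \<Rightarrow> nat" where
  "cut_size V e X = (\<Sum>u\<in>X. \<Sum>v\<in>V - X. e u v)"

definition vdeg :: "'a set \<Rightarrow> ('a \<Rightarrow> 'a \<Rightarrow> nat) \<Rightarrow> 'a \<Rightarrow> nat" where
  "vdeg V e v = (\<Sum>u\<in>V. e v u)"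

definition econn :: "nat \<Rightarrow> 'a set \<Rightarrow> ('a \<Rightarrow> 'a \<Rightarrow> nat) \<Rightarrow> bool" where
  "econn K V e \<longleftrightarrow> (\<forall>X. X \<subset> V \<and> X \<noteq> {} \<longrightarrow> K \<le> cut_size V e X)"

definition single_edge :: "'a \<Rightarrow> 'a \<Rightarrow> 'a \<Rightarrow> 'a \<Rightarrow> nat" where
  "single_edge x y = (\<lambda>u v. of_bool (u = x \<and> v = y \<or> u = y \<and> v = x))"

lemma single_edge_commute: "single_edge x y = single_edge y x"
  unfolding single_edge_def by (intro ext) auto

lemma mgraph_sym: "mgraph V e \<Longrightarrow> e u v = e v u"
  by (simp add: mgraph_def)

lemma mgraph_finite: "mgraph V e \<Longrightarrow> finite V"
  by (simp add: mgraph_def)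

lemma mgraph_outside: "mgraph V e \<Longrightarrow> u \<notin> V \<or> v \<notin> V \<Longrightarrow> e u v = 0"
  by (metis mgraph_def)

lemma mgraph_irrefl: "mgraph V e \<Longrightarrow> e u u = 0"
  by (simp add: mgraph_def)

lemma mgraph_add: "mgraph V e \<Longrightarrow> mgraph V f \<Longrightarrow> mgraph V (\<lambda>u v. e u v + f u v)"
  by (simp add: mgraph_def)

lemma mgraph_single_edge: "finite V \<Longrightarrow> x \<in> V \<Longrightarrow> y \<in> V \<Longrightarrow> x \<noteq> y \<Longrightarrow> mgraph V (single_edge x y)"
  by (auto simp: mgraph_def single_edge_def)

lemma mgraph_diff: "mgraph V e \<Longrightarrow> mgraph V f \<Longrightarrow> mgraph V (\<lambda>u v. e u v - f u v)"
  by (simp add: mgraph_def)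

lemma cut_add: "cut_size V (\<lambda>u v. e u v + f u v) X = cut_size V e X + cut_size V f X"
  by (simp add: cut_size_def sum.distrib)

lemma deg_add: "vdeg V (\<lambda>u v. e u v + f u v) x = vdeg V e x + vdeg V f x"
  by (simp add: vdeg_def sum.distrib)

text \<open>As double sums over \<open>V\<close> with 0/1 weights, the cuts of different sets share
  one index range, so inequalities between cuts reduce to inequalities between indicators.\<close>

lemma cut_indicator:
  assumes "finite V" "X \<subseteq> V"
  shows "cut_size V e X = (\<Sum>u\<in>V. \<Sum>v\<in>V. e u v * of_bool (u \<in> X \<and> v \<notin> X))"
proof -
  have "(\<Sum>u\<in>V. \<Sum>v\<in>V. e u v * of_bool (u \<in> X \<and> v \<notin> X))
      = (\<Sum>u\<in>V. if u \<in> X then (\<Sum>v\<in>V - X. e u v) else 0)"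
  proof (rule sum.cong[OF refl])
    fix u assume "u \<in> V"
    have "(\<Sum>v\<in>V. e u v * of_bool (v \<notin> X)) = (\<Sum>v\<in>V - X. e u v)"
      using assms by (intro sum.mono_neutral_cong_right) auto
    then show "(\<Sum>v\<in>V. e u v * of_bool (u \<in> X \<and> v \<notin> X)) = (if u \<in> X then (\<Sum>v\<in>V - X. e u v) else 0)"
      by auto
  qed
  also have "\<dots> = (\<Sum>u\<in>X. \<Sum>v\<in>V - X. e u v)"
    using assms by (simp add: sum.If_cases Int_absorb1)
  finally show ?thesis by (simp add: cut_size_def)
qed

lemma cut_submodular:
  assumes "finite V" "X \<subseteq> V" "Y \<subseteq> V"
  shows "cut_size V e (X \<inter> Y) + cut_size V e (X \<union> Y) \<le> cut_size V e X + cut_size V e Y"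
proof -
  have XY: "X \<inter> Y \<subseteq> V" "X \<union> Y \<subseteq> V" using assms by auto
  show ?thesis
    unfolding cut_indicator[OF assms(1) XY(1)] cut_indicator[OF assms(1) XY(2)]
      cut_indicator[OF assms(1,2)] cut_indicator[OF assms(1,3)]
      sum.distrib[symmetric] distrib_left[symmetric]
    by (intro sum_mono mult_left_mono) auto
qed

lemma cut_compl:
  assumes "mgraph U e" "X \<subseteq> V"
  shows "cut_size V e (V - X) = cut_size V e X"
proof -
  have "cut_size V e (V - X) = (\<Sum>u\<in>V - X. \<Sum>v\<in>X. e u v)"
    using assms(2) by (simp add: cut_size_def double_diff)
  also have "\<dots> = (\<Sum>v\<in>X. \<Sum>u\<in>V - X. e u v)" by (rule sum.swap)
  also have "\<dots> = cut_size V e X"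
    unfolding cut_size_def by (intro sum.cong refl mgraph_sym[OF assms(1)])
  finally show ?thesis .
qed

text \<open>Doubling counts every edge from both ends and makes the weight symmetric; the three-set
  inequality is proved in this form.\<close>

lemma cut_separated:
  assumes "mgraph V e" "X \<subseteq> V"
  shows "2 * cut_size V e X = (\<Sum>u\<in>V. \<Sum>v\<in>V. e u v * of_bool ((u \<in> X) \<noteq> (v \<in> X)))"
proof -
  have fin: "finite V" using assms(1) by (rule mgraph_finite)
  have "2 * cut_size V e X = cut_size V e X + cut_size V e (V - X)" using cut_compl[OF assms] by simp
  also have "\<dots> = (\<Sum>u\<in>V. \<Sum>v\<in>V. e u v * of_bool ((u \<in> X) \<noteq> (v \<in> X)))"
    unfolding cut_indicator[OF fin assms(2)] cut_indicator[OF fin Diff_subset]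
      sum.distrib[symmetric] distrib_left[symmetric]
    by (intro sum.cong refl arg_cong2[where f = "(*)"]) auto
  finally show ?thesis .
qed

lemma cut_single_edge:
  assumes "finite V" "X \<subseteq> V" "x \<in> V" "y \<in> V" "x \<noteq> y"
  shows "cut_size V (single_edge x y) X = of_bool ((x \<in> X) \<noteq> (y \<in> X))"
proof -
  have "cut_size V (single_edge x y) X
      = (\<Sum>u\<in>V. \<Sum>v\<in>V. of_bool (u = x \<and> v = y \<and> x \<in> X \<and> y \<notin> X) + of_bool (u = y \<and> v = x \<and> y \<in> X \<and> x \<notin> X))"
    unfolding cut_indicator[OF assms(1,2)] single_edge_def using assms(5)
    by (intro sum.cong refl) auto
  also have "\<dots> = (\<Sum>u\<in>V. \<Sum>v\<in>V. (if v = y then of_bool (u = x \<and> x \<in> X \<and> y \<notin> X) else 0))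
               + (\<Sum>u\<in>V. \<Sum>v\<in>V. (if v = x then of_bool (u = y \<and> y \<in> X \<and> x \<notin> X) else 0))"
    unfolding sum.distrib by (intro arg_cong2[where f = "(+)"] sum.cong refl) auto
  also have "\<dots> = (\<Sum>u\<in>V. if u = x then of_bool (x \<in> X \<and> y \<notin> X) else 0)
       + (\<Sum>u\<in>V. if u = y then of_bool (y \<in> X \<and> x \<notin> X) else 0)"
    using assms by (intro arg_cong2[where f = "(+)"] sum.cong refl) (auto simp: sum.delta)
  also have "\<dots> = of_bool ((x \<in> X) \<noteq> (y \<in> X))" using assms by (auto simp: sum.delta)
  finally show ?thesis .
qed

lemma deg_single_edge:
  assumes "finite V" "x \<in> V" "y \<in> V" "x \<noteq> y"
  shows "vdeg V (single_edge x y) v = of_bool (v = x \<or> v = y)"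
proof -
  have "vdeg V (single_edge x y) v = (\<Sum>u\<in>V. (if u = y then of_bool (v = x) else 0) + (if u = x then of_bool (v = y) else 0))"
    unfolding vdeg_def single_edge_def using assms by (intro sum.cong refl) auto
  also have "\<dots> = of_bool (v = x \<or> v = y)"
    using assms unfolding sum.distrib by (auto simp: sum.delta)
  finally show ?thesis .
qed

lemma cut_singleton:
  assumes "mgraph V e" "v \<in> V"
  shows "cut_size V e {v} = vdeg V e v"
proof -
  have "vdeg V e v = e v v + (\<Sum>u\<in>V - {v}. e v u)"
    unfolding vdeg_def using assms by (intro sum.remove) (auto simp: mgraph_finite)
  then show ?thesis using mgraph_irrefl[OF assms(1)] by (simp add: cut_size_def)
qed

lemma remove_edge_decomposition:
  assumes "mgraph V e" "e x y > 0"
  obtains f where "mgraph V f" "e = (\<lambda>u v. f u v + single_edge x y u v)" "x \<in> V" "y \<in> V" "x \<noteq> y"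
proof -
  have xV: "x \<in> V" using assms(2) mgraph_outside[OF assms(1), of x y] by (rule_tac ccontr) simp
  have yV: "y \<in> V" using assms(2) mgraph_outside[OF assms(1), of x y] by (rule_tac ccontr) simp
  have neq: "x \<noteq> y" using assms(2) mgraph_irrefl[OF assms(1), of x] by (rule_tac notI) simp
  note xy = xV yV neq
  have yx: "e y x > 0" using assms(2) by (simp only: mgraph_sym[OF assms(1), of y x])
  have eq: "e = (\<lambda>u v. (e u v - single_edge x y u v) + single_edge x y u v)"
    using assms(2) yx by (intro ext) (simp add: single_edge_def of_bool_def)
  have "mgraph V (\<lambda>u v. e u v - single_edge x y u v)"
    by (rule mgraph_diff[OF assms(1) mgraph_single_edge[OF mgraph_finite[OF assms(1)] xy]])
  from that[OF this eq xy] show thesis .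
qed

text \<open>Pointwise core of \<open>cut_three_sets\<close>, decided by the 64 truth assignments to
  the memberships of two vertices.\<close>

lemma three_sets_indicator:
  "of_bool (((a \<and> b) \<and> c) \<noteq> ((a' \<and> b') \<and> c')) + of_bool ((a \<and> \<not> (b \<or> c)) \<noteq> (a' \<and> \<not> (b' \<or> c')))
   + of_bool ((b \<and> \<not> (a \<or> c)) \<noteq> (b' \<and> \<not> (a' \<or> c'))) + of_bool ((c \<and> \<not> (a \<or> b)) \<noteq> (c' \<and> \<not> (a' \<or> b')))
   \<le> of_bool (a \<noteq> a') + of_bool (b \<noteq> b') + (of_bool (c \<noteq> c') :: nat)"
  by (cases a; cases b; cases c; cases a'; cases b'; cases c'; simp)

text \<open>An edge between \<open>s\<close> and \<open>t\<close> crosses all three given sets but,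
  of the four derived ones, only the intersection. The extra term records this slack of 2 per
  edge.\<close>

lemma cut_three_sets:
  assumes e: "mgraph V e" and sub: "X \<subseteq> V" "Y \<subseteq> V" "Z \<subseteq> V"
    and t: "t \<in> X \<inter> Y \<inter> Z" and s: "s \<in> V" "s \<notin> X \<union> Y \<union> Z"
  shows "cut_size V e (X \<inter> Y \<inter> Z) + cut_size V e (X - (Y \<union> Z)) + cut_size V e (Y - (X \<union> Z)) + cut_size V e (Z - (X \<union> Y)) + 2 * e s t
    \<le> cut_size V e X + cut_size V e Y + cut_size V e Z"
proof -
  have fin: "finite V" using e by (rule mgraph_finite)
  have tV: "t \<in> V" "s \<noteq> t" using t s sub by auto
  have ets: "e t s = e s t" by (rule mgraph_sym[OF e])
  have sub': "X \<inter> Y \<inter> Z \<subseteq> V" "X - (Y \<union> Z) \<subseteq> V" "Y - (X \<union> Z) \<subseteq> V" "Z - (X \<union> Y) \<subseteq> V"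
    using sub by auto
  have "(\<Sum>u\<in>V. \<Sum>v\<in>V. e u v * (2 * single_edge s t u v)) = 4 * e s t"
  proof -
    have "(\<Sum>u\<in>V. \<Sum>v\<in>V. e u v * (2 * single_edge s t u v))
      = (\<Sum>u\<in>V. (if u = s then 2 * e s t else 0) + (if u = t then 2 * e s t else 0))"
    proof (intro sum.cong refl)
      fix u assume "u \<in> V"
      have "(\<Sum>v\<in>V. e u v * (2 * single_edge s t u v))
        = (\<Sum>v\<in>V. (if v = t then (if u = s then 2 * e s t else 0) else 0) + (if v = s then (if u = t then 2 * e s t else 0) else 0))"
        using tV ets by (intro sum.cong refl) (auto simp: single_edge_def)
      also have "\<dots> = (if u = s then 2 * e s t else 0) + (if u = t then 2 * e s t else 0)"
        using tV s fin unfolding sum.distrib by (simp add: sum.delta)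
      finally show "(\<Sum>v\<in>V. e u v * (2 * single_edge s t u v)) = (if u = s then 2 * e s t else 0) + (if u = t then 2 * e s t else 0)" .
    qed
    also have "\<dots> = 4 * e s t" using tV s fin unfolding sum.distrib by (simp add: sum.delta)
    finally show ?thesis .
  qed
  then have "2 * cut_size V e (X \<inter> Y \<inter> Z) + 2 * cut_size V e (X - (Y \<union> Z)) + 2 * cut_size V e (Y - (X \<union> Z)) + 2 * cut_size V e (Z - (X \<union> Y)) + 4 * e s t
    = 2 * cut_size V e (X \<inter> Y \<inter> Z) + 2 * cut_size V e (X - (Y \<union> Z)) + 2 * cut_size V e (Y - (X \<union> Z)) + 2 * cut_size V e (Z - (X \<union> Y))
      + (\<Sum>u\<in>V. \<Sum>v\<in>V. e u v * (2 * single_edge s t u v))" by simp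
  also have "\<dots> \<le> 2 * cut_size V e X + 2 * cut_size V e Y + 2 * cut_size V e Z"
    unfolding cut_separated[OF e sub'(1)] cut_separated[OF e sub'(2)] cut_separated[OF e sub'(3)]
      cut_separated[OF e sub'(4)] cut_separated[OF e sub(1)] cut_separated[OF e sub(2)] cut_separated[OF e sub(3)]
      sum.distrib[symmetric] distrib_left[symmetric]
  proof (intro sum_mono mult_left_mono)
    fix u v
    show "of_bool ((u \<in> X \<inter> Y \<inter> Z) \<noteq> (v \<in> X \<inter> Y \<inter> Z)) + of_bool ((u \<in> X - (Y \<union> Z)) \<noteq> (v \<in> X - (Y \<union> Z)))
      + of_bool ((u \<in> Y - (X \<union> Z)) \<noteq> (v \<in> Y - (X \<union> Z))) + of_bool ((u \<in> Z - (X \<union> Y)) \<noteq> (v \<in> Z - (X \<union> Y)))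
      + 2 * single_edge s t u v
      \<le> of_bool ((u \<in> X) \<noteq> (v \<in> X)) + of_bool ((u \<in> Y) \<noteq> (v \<in> Y)) + (of_bool ((u \<in> Z) \<noteq> (v \<in> Z)) :: nat)"
    proof (cases "u = s \<and> v = t \<or> u = t \<and> v = s")
      case True
      then show ?thesis
      proof
        assume "u = s \<and> v = t"
        then have "u \<notin> X" "u \<notin> Y" "u \<notin> Z" "v \<in> X" "v \<in> Y" "v \<in> Z" "single_edge s t u v = 1"
          using t s by (simp_all add: single_edge_def)
        then show ?thesis by simp
      next
        assume "u = t \<and> v = s"
        then have "v \<notin> X" "v \<notin> Y" "v \<notin> Z" "u \<in> X" "u \<in> Y" "u \<in> Z" "single_edge s t u v = 1"
          using t s by (simp_all add: single_edge_def)
        then show ?thesis by simp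
      qed
    next
      case False
      then have "single_edge s t u v = 0" by (auto simp: single_edge_def)
      then show ?thesis using three_sets_indicator[of "u \<in> X" "u \<in> Y" "u \<in> Z" "v \<in> X" "v \<in> Y" "v \<in> Z"]
        by (simp only: Int_iff Un_iff Diff_iff mult_0_right add_0_right)
    qed
  qed simp
  finally show ?thesis by simp
qed

section \<open>Splitting off and pairing\<close>

lemma cut_insert:
  assumes "mgraph (insert s V) e" "s \<notin> V" "X \<subseteq> V"
  shows "cut_size (insert s V) e X = cut_size V e X + (\<Sum>x\<in>X. e s x)"
proof -
  have "insert s V - X = insert s (V - X)" using assms by auto
  moreover have "finite (V - X)" "s \<notin> V - X" using assms(2) mgraph_finite[OF assms(1)] by auto
  ultimately have "cut_size (insert s V) e X = (\<Sum>u\<in>X. e u s + (\<Sum>v\<in>V - X. e u v))"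
    by (simp add: cut_size_def)
  also have "\<dots> = (\<Sum>u\<in>X. e s u + (\<Sum>v\<in>V - X. e u v))"
    by (intro sum.cong refl arg_cong2[where f = "(+)"] mgraph_sym[OF assms(1)])
  finally show ?thesis by (simp add: cut_size_def sum.distrib)
qed

text \<open>Lovasz's splitting argument. If no partner is admissible, every candidate shares with
  \<open>t\<close> a set of cut at most \<open>K + 1\<close>. A minimal family of such sets covering
  the neighbours of \<open>s\<close> has at least three members, and three contradict
  \<open>cut_three_sets\<close>.\<close>

lemma ex_admissible_split:
  assumes e: "mgraph (insert s V) e" and s: "s \<notin> V" and K: "2 \<le> K"
    and even: "even (vdeg (insert s V) e s)"
    and conn: "\<And>X. X \<subset> V \<Longrightarrow> X \<noteq> {} \<Longrightarrow> K \<le> cut_size (insert s V) e X"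
    and t: "0 < e s t"
  shows "\<exists>u. (if u = t then 2 \<le> e s t else 0 < e s u) \<and>
    (\<forall>X. X \<subset> V \<and> t \<in> X \<and> u \<in> X \<longrightarrow> K + 2 \<le> cut_size (insert s V) e X)"
proof (rule ccontr)
  assume contra: "\<not> ?thesis"
  let ?W = "insert s V"
  have fin: "finite V" using mgraph_finite[OF e] by simp
  have nbr: "x \<in> V" if "0 < e s x" for x
  proof (rule ccontr)
    assume "x \<notin> V"
    then show False using that mgraph_outside[OF e, of s x] mgraph_irrefl[OF e, of s] by (cases "x = s") auto
  qed
  define E where "E X = (\<Sum>x\<in>X. e s x)" for X
  have EV: "vdeg ?W e s = E V"
    unfolding vdeg_def E_def using fin s mgraph_irrefl[OF e, of s] by simp
  \<comment> \<open>The dangerous sets around \<open>t\<close>: a split costs a cut 2, so these are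
    the ones that could fall below \<open>K\<close>.\<close>
  define D where "D = {X. X \<subset> V \<and> t \<in> X \<and> cut_size ?W e X \<le> K + 1}"
  \<comment> \<open>\<open>X\<close> and \<open>V - X\<close> have equal cuts inside
    \<open>V\<close>, so \<open>E X\<close> exceeds \<open>E (V - X)\<close> by at most 1; evenness
    of their sum rules out the 1.\<close>
  have half: "2 * E X \<le> E V" if "X \<in> D" for X
  proof -
    have X: "X \<subseteq> V" "V - X \<subset> V" "V - X \<noteq> {}" using that unfolding D_def by auto
    have "cut_size V e X + E X \<le> K + 1"
      using that cut_insert[OF e s X(1)] unfolding D_def E_def by simp
    moreover have "K \<le> cut_size V e X + E (V - X)"
      using conn[OF X(2,3)] cut_insert[OF e s Diff_subset, of X] cut_compl[OF e X(1)] unfolding E_def by simp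
    moreover have "E V = E X + E (V - X)"
      unfolding E_def using sum.subset_diff[OF X(1) fin, of "e s"] by simp
    ultimately have "E X \<le> E (V - X) + 1" "E V = E X + E (V - X)" by linarith+
    moreover have "even (E V)" using even EV by simp
    moreover have "2 * a \<le> c" if "a \<le> b + 1" "c = a + b" "even c" for a b c :: nat
      using that by presburger
    ultimately show ?thesis by blast
  qed
  define N where "N = {u. 0 < e s u}"
  have NV: "N \<subseteq> V" using nbr unfolding N_def by auto
  have tN: "t \<in> N" using t unfolding N_def by simp
  have E_all: "E X = E V" if "N \<subseteq> X" "X \<subseteq> V" for X
    unfolding E_def using that fin by (intro sum.mono_neutral_left) (auto simp: N_def)
  \<comment> \<open>A second copy of the edge \<open>st\<close> may serve as partner, which needs
    multiplicity 2.\<close>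
  define ok where "ok u \<longleftrightarrow> (if u = t then 2 \<le> e s t else 0 < e s u)" for u
  have dangerous: "\<exists>X\<in>D. u \<in> X" if "ok u" for u
  proof -
    have "\<exists>X. X \<subset> V \<and> t \<in> X \<and> u \<in> X \<and> \<not> K + 2 \<le> cut_size ?W e X"
      using contra that unfolding ok_def[symmetric] by blast
    then obtain X where X: "X \<subset> V" "t \<in> X" "u \<in> X" "\<not> K + 2 \<le> cut_size ?W e X"
      by (elim exE conjE)
    then have "X \<in> D" unfolding D_def by simp
    then show ?thesis using X(3) by blast
  qed
  have "N \<subseteq> \<Union>D"
  proof
    fix u assume u: "u \<in> N"
    show "u \<in> \<Union>D"
    proof (cases "u = t")
      case False
      then show ?thesis using dangerous[of u] u unfolding N_def ok_def by auto
    next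
      case True
      \<comment> \<open>Any other neighbour brings a dangerous set containing \<open>t\<close>; if
        there is none, all edges at \<open>s\<close> go to \<open>t\<close>, and evenness supplies a
        second copy.\<close>
      show ?thesis
      proof (cases "N = {t}")
        case True
        have "E V = E {t}" using E_all[of "{t}"] True NV by simp
        then have "even (e s t)" using even EV by (simp add: E_def)
        then have "2 \<le> e s t" using t by presburger
        then show ?thesis using dangerous[of t] \<open>u = t\<close> unfolding ok_def by auto
      next
        case False
        then obtain v where "v \<in> N" "v \<noteq> t" using tN by blast
        then have "\<exists>X\<in>D. v \<in> X" using dangerous[of v] unfolding N_def ok_def by auto
        then show ?thesis using \<open>u = t\<close> unfolding D_def by auto
      qed
    qed
  qed
  then have ne: "{C. C \<subseteq> D \<and> N \<subseteq> \<Union>C} \<noteq> {}" by blast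
  have "D \<subseteq> Pow V" unfolding D_def by blast
  then have finD: "finite D" using fin finite_subset finite_Pow_iff by metis
  have "{C. C \<subseteq> D \<and> N \<subseteq> \<Union>C} \<subseteq> Pow D" by blast
  then have "finite {C. C \<subseteq> D \<and> N \<subseteq> \<Union>C}" using finD finite_subset finite_Pow_iff by metis
  note this ne
  from finite_has_minimal[OF this] obtain C where C: "C \<subseteq> D" "N \<subseteq> \<Union>C"
    and min: "\<And>C'. C' \<subseteq> D \<Longrightarrow> N \<subseteq> \<Union>C' \<Longrightarrow> C' \<subseteq> C \<Longrightarrow> C = C'"
    by auto
  \<comment> \<open>Minimality gives every member of the cover a private neighbour of
    \<open>s\<close>, so the differences used below are nonempty.\<close>
  have own: "\<exists>x\<in>N. x \<in> X \<and> (\<forall>Y\<in>C. Y \<noteq> X \<longrightarrow> x \<notin> Y)" if "X \<in> C" for X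
  proof -
    have "\<not> N \<subseteq> \<Union>(C - {X})" using min[of "C - {X}"] C that by auto
    then obtain x where "x \<in> N" "x \<notin> \<Union>(C - {X})" by blast
    then show ?thesis using C(2) by blast
  qed
  have subV: "X \<subseteq> V" "t \<in> X" if "X \<in> C" for X using that C unfolding D_def by auto
  have Et: "0 < E V" unfolding E_def using t fin nbr by (meson sum_pos2 zero_le)
  obtain X where X: "X \<in> C" using C tN by auto
  have "C \<noteq> {X}"
  proof
    assume "C = {X}"
    then have "E X = E V" using C subV by (intro E_all) auto
    then show False using half[of X] C X Et by auto
  qed
  then obtain Y where Y: "Y \<in> C" "Y \<noteq> X" using X by blast
  \<comment> \<open>Two sets with at most half of the edges each could cover all of them only
    without overlap, but both contain \<open>t\<close>.\<close>
  have "C \<noteq> {X, Y}"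
  proof
    assume CXY: "C = {X, Y}"
    have fXY: "finite X" "finite Y" using subV X Y fin finite_subset by blast+
    have "E (X \<union> Y) = E V" using C subV CXY by (intro E_all) auto
    moreover have "E (X \<union> Y) + E (X \<inter> Y) = E X + E Y"
      unfolding E_def using fXY by (rule sum.union_inter)
    moreover have "0 < E (X \<inter> Y)"
      unfolding E_def using t fXY subV X Y by (meson IntI finite_Int sum_pos2 zero_le)
    moreover have "2 * E X \<le> E V" "2 * E Y \<le> E V" using half X Y C by auto
    ultimately show False by linarith
  qed
  then obtain Z where Z: "Z \<in> C" "Z \<noteq> X" "Z \<noteq> Y" using X Y by blast
  have low: "K \<le> cut_size ?W e (X \<inter> Y \<inter> Z)" "K \<le> cut_size ?W e (X - (Y \<union> Z))"
      "K \<le> cut_size ?W e (Y - (X \<union> Z))" "K \<le> cut_size ?W e (Z - (X \<union> Y))"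
  proof -
    have sub: "X \<subset> V" "Y \<subset> V" "Z \<subset> V" using X Y(1) Z(1) C(1) unfolding D_def by blast+
    obtain x where "x \<in> X" "x \<notin> Y" "x \<notin> Z" using own[OF X] Y Z by blast
    moreover obtain y where "y \<in> Y" "y \<notin> X" "y \<notin> Z" using own[OF Y(1)] X Y(2) Z by metis
    moreover obtain z where "z \<in> Z" "z \<notin> X" "z \<notin> Y" using own[OF Z(1)] X Y Z by metis
    moreover have "t \<in> X \<inter> Y \<inter> Z" using subV(2) X Y Z by blast
    ultimately have "X \<inter> Y \<inter> Z \<noteq> {}" "X - (Y \<union> Z) \<noteq> {}" "Y - (X \<union> Z) \<noteq> {}" "Z - (X \<union> Y) \<noteq> {}"
      by blast+
    moreover have "X \<inter> Y \<inter> Z \<subset> V" "X - (Y \<union> Z) \<subset> V" "Y - (X \<union> Z) \<subset> V" "Z - (X \<union> Y) \<subset> V"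
      using sub by blast+
    ultimately show "K \<le> cut_size ?W e (X \<inter> Y \<inter> Z)" "K \<le> cut_size ?W e (X - (Y \<union> Z))"
      "K \<le> cut_size ?W e (Y - (X \<union> Z))" "K \<le> cut_size ?W e (Z - (X \<union> Y))"
      using conn by simp_all
  qed
  have "cut_size ?W e (X \<inter> Y \<inter> Z) + cut_size ?W e (X - (Y \<union> Z)) + cut_size ?W e (Y - (X \<union> Z))
      + cut_size ?W e (Z - (X \<union> Y)) + 2 * e s t \<le> cut_size ?W e X + cut_size ?W e Y + cut_size ?W e Z"
    using X Y Z subV s by (intro cut_three_sets[OF e]) auto
  moreover have "cut_size ?W e X \<le> K + 1" "cut_size ?W e Y \<le> K + 1" "cut_size ?W e Z \<le> K + 1"
    using X Y Z C unfolding D_def by auto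
  \<comment> \<open>The bounds combine to \<open>4 * K + 2 \<le> 3 * (K + 1)\<close>, contradicting
    \<open>2 \<le> K\<close>.\<close>
  ultimately show False using low K t by linarith
qed

text \<open>Induction on the degree of \<open>s\<close>. A split lowers the cut of a subset of
  \<open>V\<close> by 2 if it contains both partners and leaves it alone otherwise; it keeps all
  degree parities in \<open>V\<close>.\<close>

lemma complete_splitting:
  assumes s: "s \<notin> V" and K: "2 \<le> K"
    and "mgraph (insert s V) e" "even (vdeg (insert s V) e s)"
    and "\<And>X. X \<subset> V \<Longrightarrow> X \<noteq> {} \<Longrightarrow> K \<le> cut_size (insert s V) e X"
  shows "\<exists>e'. mgraph V e' \<and> (\<forall>X\<subseteq>V. cut_size V e' X \<le> cut_size (insert s V) e X)
    \<and> (\<forall>v\<in>V. even (vdeg V e' v + vdeg (insert s V) e v)) \<and> econn K V e'"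
  using assms(3-5)
proof (induction "vdeg (insert s V) e s" arbitrary: e rule: less_induct)
  case less
  let ?W = "insert s V"
  note e = less.prems(1)
  have fin: "finite V" using mgraph_finite[OF e] by simp
  show ?case
  proof (cases "vdeg ?W e s = 0")
    case True
    then have z: "e s x = 0" for x
      using fin mgraph_outside[OF e, of s x] unfolding vdeg_def by (cases "x \<in> ?W") auto
    have z': "e x s = 0" for x using z[of x] mgraph_sym[OF e, of x s] by simp
    have "mgraph V e"
      unfolding mgraph_def using e z fin unfolding mgraph_def by (metis insert_iff)
    moreover have cut: "cut_size ?W e X = cut_size V e X" if "X \<subseteq> V" for X
      using cut_insert[OF e s that] z by simp
    moreover have "vdeg ?W e v = vdeg V e v" for v
      unfolding vdeg_def using fin s z' by simp
    ultimately show ?thesis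
      using less.prems(3) unfolding econn_def by (intro exI[of _ e]) (auto simp: psubset_imp_subset)
  next
    case False
    then obtain t where t: "0 < e s t" unfolding vdeg_def by (metis neq0_conv sum.neutral)
    obtain u where u: "if u = t then 2 \<le> e s t else 0 < e s u"
      and adm: "\<And>X. X \<subset> V \<Longrightarrow> t \<in> X \<Longrightarrow> u \<in> X \<Longrightarrow> K + 2 \<le> cut_size ?W e X"
      using ex_admissible_split[OF e s K less.prems(2,3) t] by blast
    obtain f where f: "mgraph ?W f" "e = (\<lambda>x y. f x y + single_edge s t x y)" and tW: "s \<in> ?W" "t \<in> ?W" "s \<noteq> t"
      by (rule remove_edge_decomposition[OF e t])
    have "0 < f s u" using u tW unfolding f(2) single_edge_def by (auto split: if_splits)
    from remove_edge_decomposition[OF f(1) this]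
    obtain g where g: "mgraph ?W g" "f = (\<lambda>x y. g x y + single_edge s u x y)" and uW: "s \<in> ?W" "u \<in> ?W" "s \<noteq> u" .
    have tu: "t \<in> V" "u \<in> V" using tW uW by auto
    have finW: "finite ?W" using fin by simp
    \<comment> \<open>If both split edges lead to \<open>t\<close>, the new edge would be a loop and
      is dropped; the degree of \<open>t\<close> falls by 2, so its parity survives.\<close>
    define h where "h = (if u = t then (\<lambda>x y. 0) else single_edge t u)"
    have h: "mgraph ?W h" unfolding h_def using mgraph_single_edge[OF finW, of t u] tu finW by (auto simp: mgraph_def)
    define e1 where "e1 = (\<lambda>x y. g x y + h x y)"
    have e1: "mgraph ?W e1" unfolding e1_def using g(1) h by (rule mgraph_add)
    have cut_e: "cut_size ?W e X = cut_size ?W g X + cut_size ?W (single_edge s u) X + cut_size ?W (single_edge s t) X" for X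
      unfolding f(2) g(2) cut_add by simp
    have deg_e: "vdeg ?W e v = vdeg ?W g v + vdeg ?W (single_edge s u) v + vdeg ?W (single_edge s t) v" for v
      unfolding f(2) g(2) deg_add by simp
    have cut_h: "cut_size ?W h X = of_bool ((t \<in> X) \<noteq> (u \<in> X))" if "X \<subseteq> V" for X
      unfolding h_def using cut_single_edge[OF finW subset_insertI2[OF that], of t u] tu
      by (cases "u = t") (simp_all add: cut_size_def)
    have cut1: "cut_size ?W e1 X + 2 * of_bool (t \<in> X \<and> u \<in> X) = cut_size ?W e X" if "X \<subseteq> V" for X
    proof -
      have "X \<subseteq> ?W" "s \<notin> X" using that s by auto
      then show ?thesis
        unfolding e1_def cut_add cut_e cut_h[OF that]
        using cut_single_edge[OF finW, of X s u] cut_single_edge[OF finW, of X s t] tW uW by auto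
    qed
    have deg_h: "vdeg ?W h v = (if u = t then 0 else of_bool (v = t \<or> v = u))" for v
      unfolding h_def using deg_single_edge[OF finW, of t u v] tu by (auto simp: vdeg_def)
    have deg_su: "vdeg ?W (single_edge s u) v = of_bool (v = s \<or> v = u)" for v using deg_single_edge[OF finW uW] .
    have deg_st: "vdeg ?W (single_edge s t) v = of_bool (v = s \<or> v = t)" for v using deg_single_edge[OF finW tW] .
    have deg1: "vdeg ?W e1 s + 2 = vdeg ?W e s"
      unfolding e1_def deg_add deg_e deg_h deg_su deg_st using tW uW by auto
    have par: "even (vdeg ?W e1 v + vdeg ?W e v)" if "v \<in> V" for v
      unfolding e1_def deg_add deg_e deg_h deg_su deg_st using that s by auto
    have conn1: "K \<le> cut_size ?W e1 X" if "X \<subset> V" "X \<noteq> {}" for X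
      using cut1[of X] adm[of X] less.prems(3)[of X] that by (auto split: if_splits simp: of_bool_def)
    have "even (vdeg ?W e1 s)" using deg1 less.prems(2) by (metis even_add even_numeral)
    then obtain e' where e': "mgraph V e'" "\<forall>X\<subseteq>V. cut_size V e' X \<le> cut_size ?W e1 X"
        "\<forall>v\<in>V. even (vdeg V e' v + vdeg ?W e1 v)" "econn K V e'"
      using less.hyps[OF _ e1 _ conn1] deg1 by auto
    have "cut_size V e' X \<le> cut_size ?W e X" if "X \<subseteq> V" for X
      using e'(2) that cut1[OF that] by (metis le_add1 le_trans)
    moreover have "even (vdeg V e' v + vdeg ?W e v)" if "v \<in> V" for v
      using e'(3) par that by (metis even_add)
    ultimately show ?thesis using e' by blast
  qed
qed

section \<open>Tight cuts, tight vertices and the pairing\<close>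

text \<open>Removing one edge lowers only the cuts between its ends, each by 1, so a cut that fails
  afterwards was tight. Passing to the complement puts \<open>x\<close> inside.\<close>

lemma critical_edge_in_tight_cut:
  assumes e: "mgraph V e" and f: "e = (\<lambda>u v. f u v + single_edge x y u v)"
    and xy: "x \<in> V" "y \<in> V" "x \<noteq> y" and conn: "econn K V e" "\<not> econn K V f"
  shows "\<exists>X. X \<subset> V \<and> X \<noteq> {} \<and> cut_size V e X = K \<and> x \<in> X \<and> y \<notin> X"
proof -
  obtain X where X: "X \<subset> V" "X \<noteq> {}" "cut_size V f X < K" using conn(2) unfolding econn_def by (meson not_le)
  have "cut_size V e X = cut_size V f X + of_bool ((x \<in> X) \<noteq> (y \<in> X))"
    unfolding f cut_add using cut_single_edge[OF mgraph_finite[OF e] _ xy, of X] X by auto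
  moreover have "K \<le> cut_size V e X" using conn(1) X unfolding econn_def by blast
  ultimately have sep: "(x \<in> X) \<noteq> (y \<in> X)" "cut_size V e X = K"
    using X by (auto simp: of_bool_def split: if_splits)
  show ?thesis
  proof (cases "x \<in> X")
    case True then show ?thesis using X sep by blast
  next
    case False
    have "cut_size V e (V - X) = K" using cut_compl[OF e, of X V] X sep by auto
    then show ?thesis using X sep xy False by (intro exI[of _ "V - X"]) auto
  qed
qed

text \<open>A least tight set \<open>X\<close> is a singleton: otherwise it contains an edge, and
  uncrossing \<open>X\<close> with a tight set through that edge yields a smaller tight set.\<close>

lemma minimal_has_tight_vertex:
  assumes e: "mgraph V e" and conn: "econn K V e" and K: "1 \<le> K" and V: "2 \<le> card V"
    and min: "\<And>x y. 0 < e x y \<Longrightarrow> \<exists>X. X \<subset> V \<and> X \<noteq> {} \<and> cut_size V e X = K \<and> x \<in> X \<and> y \<notin> X"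
  shows "\<exists>s\<in>V. vdeg V e s = K"
proof -
  have fin: "finite V" using e by (rule mgraph_finite)
  define tight where "tight X \<longleftrightarrow> X \<subset> V \<and> X \<noteq> {} \<and> cut_size V e X = K" for X
  have single: "{v} \<subset> V" if "v \<in> V" for v
  proof -
    have "V \<noteq> {v}" using V by auto
    then show ?thesis using that by auto
  qed
  have degK: "K \<le> vdeg V e v" if "v \<in> V" for v
    using conn single[OF that] cut_singleton[OF e that] unfolding econn_def by (metis insert_not_empty)
  obtain v where v: "v \<in> V" using V by (metis card.empty ex_in_conv not_numeral_le_zero)
  then have "vdeg V e v \<noteq> 0" using degK K by fastforce
  then obtain u where "0 < e v u" unfolding vdeg_def by (metis neq0_conv sum.neutral)
  then have "\<exists>X. tight X" using min unfolding tight_def by blast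
  then obtain X where X: "tight X" and least: "\<And>Y. tight Y \<Longrightarrow> card X \<le> card Y"
    using ex_has_least_nat[of tight _ card] by blast
  have XV: "X \<subset> V" "X \<noteq> {}" "cut_size V e X = K" using X unfolding tight_def by auto
  have finX: "finite X" using XV fin finite_subset by auto
  have smaller: False if "tight Y" "Y \<subset> X" for Y
    using least[OF that(1)] psubset_card_mono[OF finX that(2)] by simp
  show ?thesis
  proof (cases "card X = 1")
    case True
    then obtain s where "X = {s}" by (auto simp: card_1_singleton_iff)
    then show ?thesis using XV cut_singleton[OF e, of s] by auto
  next
    case False
    \<comment> \<open>Without inner edges the degrees in \<open>X\<close> would sum to
      \<open>K\<close>, yet each of its at least two vertices has degree at least
      \<open>K\<close>.\<close>
    have "\<exists>u\<in>X. \<exists>v\<in>X. 0 < e u v"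
    proof (rule ccontr)
      assume no: "\<not> ?thesis"
      have "(\<Sum>u\<in>X. vdeg V e u) = (\<Sum>u\<in>X. (\<Sum>v\<in>V - X. e u v) + (\<Sum>v\<in>X. e u v))"
        unfolding vdeg_def using sum.subset_diff[of X V] XV fin by (intro sum.cong refl) auto
      also have "\<dots> = cut_size V e X + (\<Sum>u\<in>X. \<Sum>v\<in>X. e u v)" by (simp add: cut_size_def sum.distrib)
      also have "\<dots> = K" using no XV by simp
      finally have "(\<Sum>u\<in>X. vdeg V e u) = K" .
      moreover have "card X * K \<le> (\<Sum>u\<in>X. vdeg V e u)"
        using sum_bounded_below[of X K "vdeg V e"] degK XV by auto
      moreover have "2 \<le> card X" using False XV finX by (metis Suc_1 Suc_leI card_gt_0_iff le_neq_implies_less One_nat_def)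
      ultimately have "2 * K \<le> K" by (metis le_trans mult_le_mono1)
      then show False using K by simp
    qed
    then obtain u v where uv: "u \<in> X" "v \<in> X" "0 < e u v" by blast
    obtain Y where Y: "Y \<subset> V" "cut_size V e Y = K" "u \<in> Y" "v \<notin> Y"
      using min[OF uv(3)] by blast
    show ?thesis
    proof (cases "X \<union> Y = V")
      case False
      then have P: "X \<inter> Y \<subset> V" "X \<inter> Y \<noteq> {}" "X \<union> Y \<subset> V" "X \<union> Y \<noteq> {}"
        using XV Y uv by auto
      then have "K \<le> cut_size V e (X \<inter> Y)" "K \<le> cut_size V e (X \<union> Y)"
        using conn unfolding econn_def by blast+
      moreover have "cut_size V e (X \<inter> Y) + cut_size V e (X \<union> Y) \<le> 2 * K"
        using cut_submodular[OF fin, of X Y e] XV Y by auto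
      ultimately have "tight (X \<inter> Y)" using P unfolding tight_def by auto
      then show ?thesis using smaller[of "X \<inter> Y"] uv Y by blast
    next
      case True
      \<comment> \<open>Here the union gives no proper cut, but the complement of \<open>Y\<close>
        is tight, lies inside \<open>X\<close> and misses \<open>u\<close>.\<close>
      have "cut_size V e (V - Y) = K" using cut_compl[OF e, of Y V] Y by auto
      then have "tight (V - Y)" using Y uv XV unfolding tight_def by auto
      then show ?thesis using smaller[of "V - Y"] uv Y True by blast
    qed
  qed
qed

text \<open>A generalisation of Nash-Williams' odd-vertex pairing: the demand graph \<open>M\<close> need not be a matching.\<close>

lemma ex_pairing:
  assumes "mgraph V e" "econn K V e" "even K" "2 \<le> K"
  shows "\<exists>M. mgraph V M \<and> (\<forall>v\<in>V. even (vdeg V e v + vdeg V M v))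
    \<and> (\<forall>X. X \<subset> V \<and> X \<noteq> {} \<longrightarrow> cut_size V M X + K \<le> cut_size V e X)"
  using assms
\<comment> \<open>Removing an edge lowers the degree sum; splitting off a vertex lowers the number
  of vertices and raises no degree.\<close>
proof (induction "card V + (\<Sum>v\<in>V. vdeg V e v)" arbitrary: V e rule: less_induct)
  case less
  note e = less.prems(1) and conn = less.prems(2)
  have fin: "finite V" using e by (rule mgraph_finite)
  define red where "red \<longleftrightarrow> (\<exists>x y f. mgraph V f \<and> (\<forall>u v. e u v = f u v + single_edge x y u v)
      \<and> x \<in> V \<and> y \<in> V \<and> x \<noteq> y \<and> econn K V f)"
  have "card V \<le> 1 \<or> 2 \<le> card V" by linarith
  then consider (small) "card V \<le> 1" | (redundant) red | (minimal) "2 \<le> card V" "\<not> red" by blast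
  then show ?case
  proof cases
    case small
    have all: "u = v" if "u \<in> V" "v \<in> V" for u v
      using small fin that by (metis card_le_Suc0_iff_eq One_nat_def)
    have "vdeg V e v = 0" if "v \<in> V" for v
      unfolding vdeg_def using all that mgraph_irrefl[OF e] by (metis sum.neutral)
    moreover have "\<not> (X \<subset> V \<and> X \<noteq> {})" for X using all by blast
    ultimately show ?thesis using fin
      by (intro exI[of _ "\<lambda>u v. 0"]) (auto simp: mgraph_def vdeg_def)
  next
    case redundant
    then obtain x y f where f1: "mgraph V f" "\<And>u v. e u v = f u v + single_edge x y u v"
      and xy: "x \<in> V" "y \<in> V" "x \<noteq> y" and cf: "econn K V f" unfolding red_def by blast
    have "e = (\<lambda>u v. f u v + single_edge x y u v)" using f1(2) by (intro ext)
    note f = f1(1) this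
    have dege: "vdeg V e v = vdeg V f v + of_bool (v = x \<or> v = y)" for v
      unfolding f(2) deg_add deg_single_edge[OF fin xy] by simp
    have "(\<Sum>v\<in>V. of_bool (v = x \<or> v = y)) > (0::nat)"
      using sum_pos2[OF fin xy(1), of "\<lambda>v. of_bool (v = x \<or> v = y) :: nat"] by simp
    then have "card V + (\<Sum>v\<in>V. vdeg V f v) < card V + (\<Sum>v\<in>V. vdeg V e v)"
      unfolding dege sum.distrib by simp
    from less.hyps[OF this f(1) cf less.prems(3,4)]
    obtain M where M: "mgraph V M" "\<forall>v\<in>V. even (vdeg V f v + vdeg V M v)"
      "\<forall>X. X \<subset> V \<and> X \<noteq> {} \<longrightarrow> cut_size V M X + K \<le> cut_size V f X" by blast
    \<comment> \<open>The redundant edge is added to the demand graph: it adds the same amount to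
      both sides of each cut inequality and corrects the parities at its ends.\<close>
    define M' where "M' = (\<lambda>u v. M u v + single_edge x y u v)"
    have "mgraph V M'" unfolding M'_def by (rule mgraph_add[OF M(1) mgraph_single_edge[OF fin xy]])
    moreover have "even (vdeg V e v + vdeg V M' v)" if "v \<in> V" for v
      using M(2) that unfolding M'_def deg_add dege deg_single_edge[OF fin xy] by auto
    moreover have "cut_size V M' X + K \<le> cut_size V e X" if "X \<subset> V" "X \<noteq> {}" for X
      using M(3) that unfolding M'_def f(2) cut_add by auto
    ultimately show ?thesis by blast
  next
    case minimal
    have "\<exists>X. X \<subset> V \<and> X \<noteq> {} \<and> cut_size V e X = K \<and> x \<in> X \<and> y \<notin> X" if pos: "0 < e x y" for x y
    proof -
      obtain f where f: "mgraph V f" "e = (\<lambda>u v. f u v + single_edge x y u v)" and xy: "x \<in> V" "y \<in> V" "x \<noteq> y"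
        by (rule remove_edge_decomposition[OF e pos])
      have "\<not> econn K V f" using minimal(2) f(1) fun_cong[OF fun_cong[OF f(2)]] xy unfolding red_def by blast
      then show ?thesis using critical_edge_in_tight_cut[OF e f(2) xy conn] by blast
    qed
    then obtain s where s: "s \<in> V" "vdeg V e s = K"
      using minimal_has_tight_vertex[OF e conn _ minimal(1)] less.prems(4) by fastforce
    define V' where "V' = V - {s}"
    have V: "insert s V' = V" "s \<notin> V'" "finite V'" using s fin unfolding V'_def by auto
    have "\<exists>e'. mgraph V' e' \<and> (\<forall>X\<subseteq>V'. cut_size V' e' X \<le> cut_size (insert s V') e X)
        \<and> (\<forall>v\<in>V'. even (vdeg V' e' v + vdeg (insert s V') e v)) \<and> econn K V' e'"
    proof (rule complete_splitting[OF V(2) less.prems(4)])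
      show "mgraph (insert s V') e" "even (vdeg (insert s V') e s)" using e s less.prems(3) V(1) by simp_all
      fix X assume "X \<subset> V'" "X \<noteq> {}"
      moreover from this have "X \<subset> V" using V(1) by blast
      ultimately show "K \<le> cut_size (insert s V') e X" using conn V(1) unfolding econn_def by blast
    qed
    then obtain e' where e': "mgraph V' e'" "\<And>X. X \<subseteq> V' \<Longrightarrow> cut_size V' e' X \<le> cut_size V e X"
       "\<And>v. v \<in> V' \<Longrightarrow> even (vdeg V' e' v + vdeg V e v)" "econn K V' e'"
      unfolding V by blast
    have "vdeg V' e' v \<le> vdeg V e v" if "v \<in> V'" for v
      using e'(2)[of "{v}"] cut_singleton[OF e'(1) that] cut_singleton[OF e, of v] that V by auto
    then have "(\<Sum>v\<in>V'. vdeg V' e' v) \<le> (\<Sum>v\<in>V'. vdeg V e v)" by (rule sum_mono)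
    also have "\<dots> \<le> (\<Sum>v\<in>V. vdeg V e v)" using V fin by (intro sum_mono2) auto
    finally have "card V' + (\<Sum>v\<in>V'. vdeg V' e' v) < card V + (\<Sum>v\<in>V. vdeg V e v)"
      using V by (metis add_less_le_mono card_insert_disjoint lessI)
    from less.hyps[OF this e'(1,4) less.prems(3,4)]
    obtain M where M: "mgraph V' M" "\<forall>v\<in>V'. even (vdeg V' e' v + vdeg V' M v)"
      "\<forall>X. X \<subset> V' \<and> X \<noteq> {} \<longrightarrow> cut_size V' M X + K \<le> cut_size V' e' X" by blast
    have MV: "mgraph (insert s V') M" using M(1) V unfolding mgraph_def by blast
    have Ms: "M s x = 0" "M x s = 0" for x using mgraph_outside[OF M(1)] V by auto
    have degM: "vdeg V M v = vdeg V' M v" for v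
      using V(2,3) Ms unfolding V(1)[symmetric] vdeg_def by simp
    have cutM: "cut_size V M X = cut_size V' M X" if "X \<subseteq> V'" for X
      using cut_insert[OF MV V(2) that] Ms V(1) by simp
    have "even (vdeg V e v + vdeg V M v)" if "v \<in> V" for v
    proof (cases "v = s")
      case True
      then show ?thesis using s(2) Ms less.prems(3) by (simp add: vdeg_def)
    next
      case False
      then have "v \<in> V'" using that V by auto
      then show ?thesis using M(2) e'(3) degM by (metis even_add)
    qed
    \<comment> \<open>For \<open>X = V'\<close> the smaller graph says nothing, but no demand edge
      leaves \<open>V'\<close>, so connectivity of \<open>e\<close> suffices.\<close>
    moreover have avoid: "cut_size V M X + K \<le> cut_size V e X" if "X \<subseteq> V'" "X \<noteq> {}" for X
    proof (cases "X = V'")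
      case True
      have "cut_size V' M X = 0" unfolding True cut_size_def by simp
      moreover have "X \<subset> V" using that V by auto
      then have "K \<le> cut_size V e X" using conn that unfolding econn_def by blast
      ultimately show ?thesis using cutM[OF that(1)] by simp
    next
      case False
      then have "cut_size V' M X + K \<le> cut_size V' e' X" using M(3) that by auto
      also have "\<dots> \<le> cut_size V e X" using e'(2) that by blast
      finally show ?thesis using cutM[OF that(1)] by simp
    qed
    moreover have "cut_size V M X + K \<le> cut_size V e X" if "X \<subset> V" "X \<noteq> {}" for X
    proof (cases "s \<in> X")
      case False
      then show ?thesis using avoid[of X] that V by auto
    next
      case True
      then have "cut_size V M (V - X) + K \<le> cut_size V e (V - X)" using avoid[of "V - X"] that V by auto
      then show ?thesis using cut_compl[OF e, of X V] cut_compl[OF M(1), of X V] that by auto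
    qed
    ultimately show ?thesis using MV[unfolded V(1)] by blast
  qed
qed

section \<open>Orientations\<close>

text \<open>\<open>a u v\<close> counts the copies of the edge \<open>uv\<close> oriented from
  \<open>u\<close> to \<open>v\<close>. Two edges \<open>vx\<close> and \<open>vy\<close> are
  replaced by \<open>xy\<close>, and the orientation of \<open>xy\<close> is lifted back to a path
  through \<open>v\<close>.\<close>

lemma ex_eulerian_orientation:
  assumes "mgraph V w" "\<forall>v\<in>V. even (vdeg V w v)"
  shows "\<exists>a. (\<forall>u v. a u v + a v u = w u v) \<and> (\<forall>v\<in>V. (\<Sum>u\<in>V. a v u) = (\<Sum>u\<in>V. a u v :: nat))"
  using assms
proof (induction "\<Sum>v\<in>V. vdeg V w v" arbitrary: w rule: less_induct)
  case less
  note w = less.prems(1)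
  have fin: "finite V" using w by (rule mgraph_finite)
  define arc :: "'a \<Rightarrow> 'a \<Rightarrow> 'a \<Rightarrow> 'a \<Rightarrow> nat" where "arc x y = (\<lambda>u v. of_bool (u = x \<and> v = y))" for x y
  have arc_out: "(\<Sum>u\<in>V. arc x y v u) = of_bool (v = x)" if "y \<in> V" for x y v
    unfolding arc_def using fin that by (cases "v = x") (simp_all add: of_bool_def)
  have arc_in: "(\<Sum>u\<in>V. arc x y u v) = of_bool (v = y)" if "x \<in> V" for x y v
    unfolding arc_def using fin that by (cases "v = y") (simp_all add: of_bool_def)
  have arc_edge: "single_edge x y u v = arc x y u v + arc x y v u" if "x \<noteq> y" for x y u v
    unfolding arc_def single_edge_def using that by auto
  show ?case
  proof (cases "\<exists>v x. 0 < w v x")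
    case False
    then have "w u v = 0" for u v by simp
    then show ?thesis by (intro exI[of _ "\<lambda>u v. 0"]) simp
  next
    case True
    then obtain v x where "0 < w v x" by blast
    from remove_edge_decomposition[OF w this]
    obtain f where f: "mgraph V f" "w = (\<lambda>a b. f a b + single_edge v x a b)" and vx: "v \<in> V" "x \<in> V" "v \<noteq> x" .
    have "even (vdeg V w v)" using less.prems(2) vx by blast
    then have "odd (vdeg V f v)" unfolding f(2) deg_add deg_single_edge[OF fin vx] by simp
    then have "vdeg V f v \<noteq> 0" by (metis even_zero)
    then obtain y where "0 < f v y" unfolding vdeg_def by (metis neq0_conv sum.neutral)
    from remove_edge_decomposition[OF f(1) this]
    obtain g where g: "mgraph V g" "f = (\<lambda>a b. g a b + single_edge v y a b)" and vy: "v \<in> V" "y \<in> V" "v \<noteq> y" .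
    have wg: "w a b = g a b + single_edge v y a b + single_edge v x a b" for a b unfolding f(2) g(2) by simp
    have degw: "vdeg V w a = vdeg V g a + of_bool (a = v \<or> a = y) + of_bool (a = v \<or> a = x)" for a
      unfolding f(2) g(2) deg_add deg_single_edge[OF fin vx] deg_single_edge[OF fin vy] by simp
    have shorter: "(\<Sum>a\<in>V. vdeg V h a) < (\<Sum>a\<in>V. vdeg V w a)"
      if "\<And>a. vdeg V h a \<le> vdeg V w a" "vdeg V h v < vdeg V w v" for h
      using that vx fin by (intro sum_strict_mono2[of _ _ v] | blast intro: sum_strict_mono_ex1)+
    show ?thesis
    proof (cases "x = y")
      case True
      have "(\<Sum>a\<in>V. vdeg V g a) < (\<Sum>a\<in>V. vdeg V w a)"
        by (rule shorter) (auto simp: degw)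
      moreover have "\<forall>a\<in>V. even (vdeg V g a)"
        using less.prems(2) unfolding degw True by auto
      ultimately obtain a where a: "\<And>u v. a u v + a v u = g u v" "\<And>v. v \<in> V \<Longrightarrow> (\<Sum>u\<in>V. a v u) = (\<Sum>u\<in>V. a u v)"
        using less.hyps[OF _ g(1)] by blast
      \<comment> \<open>Two parallel edges are simply oriented oppositely.\<close>
      define b where "b p q = a p q + arc v x p q + arc x v p q" for p q
      have "b p q + b q p = w p q" for p q
      proof -
        have "arc x v p q = arc v x q p" "arc x v q p = arc v x p q" unfolding arc_def by (simp_all add: conj_commute)
        moreover have "w p q = g p q + single_edge v x p q + single_edge v x p q" using wg True by simp
        ultimately show ?thesis unfolding b_def using a(1)[of p q] arc_edge[OF vx(3), of p q] by linarith
      qed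
      moreover have "(\<Sum>u\<in>V. b p u) = (\<Sum>u\<in>V. b u p)" if "p \<in> V" for p
        unfolding b_def sum.distrib using a(2)[OF that] vx by (simp add: arc_out arc_in)
      ultimately show ?thesis by blast
    next
      case False
      define h where "h = (\<lambda>a b. g a b + single_edge x y a b)"
      have h: "mgraph V h" unfolding h_def by (rule mgraph_add[OF g(1) mgraph_single_edge[OF fin vx(2) vy(2) False]])
      have degh: "vdeg V h a = vdeg V g a + of_bool (a = x \<or> a = y)" for a
        unfolding h_def deg_add deg_single_edge[OF fin vx(2) vy(2) False] by simp
      have "(\<Sum>a\<in>V. vdeg V h a) < (\<Sum>a\<in>V. vdeg V w a)"
        by (rule shorter) (use vx vy False in \<open>auto simp: degw degh\<close>)
      moreover have "\<forall>a\<in>V. even (vdeg V h a)"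
      proof
        fix a assume "a \<in> V"
        then have "even (vdeg V w a)" using less.prems(2) by blast
        then show "even (vdeg V h a)" unfolding degw degh using vx vy False by (auto split: if_splits simp: of_bool_def)
      qed
      ultimately obtain a where a: "\<And>u v. a u v + a v u = h u v" "\<And>v. v \<in> V \<Longrightarrow> (\<Sum>u\<in>V. a v u) = (\<Sum>u\<in>V. a u v)"
        using less.hyps[OF _ h] by blast
      \<comment> \<open>Some copy of \<open>xy\<close> is oriented, in one direction or the other;
        it is replaced by the path from \<open>p\<close> over \<open>v\<close> to \<open>q\<close>,
        which keeps every vertex balanced.\<close>
      have "a x y + a y x \<ge> 1" unfolding a(1) h_def single_edge_def by simp
      then obtain p q where pq: "p = x \<and> q = y \<or> p = y \<and> q = x" "1 \<le> a p q"
        by (metis add_is_0 less_one not_le zero_neq_one)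
      have pqV: "p \<in> V" "q \<in> V" "p \<noteq> q" "v \<noteq> p" "v \<noteq> q" using pq vx vy False by auto
      define b where "b r s = a r s - arc p q r s" for r s
      have ab: "a r s = b r s + arc p q r s" for r s unfolding b_def arc_def using pq by auto
      define d where "d r s = b r s + arc p v r s + arc v q r s" for r s
      have "d r s + d s r = w r s" for r s
      proof -
        have "single_edge x y r s = single_edge p q r s"
          "single_edge v y r s + single_edge v x r s = single_edge p v r s + single_edge v q r s"
          using pq(1) by (metis add.commute single_edge_commute)+
        then have "w r s + single_edge p q r s = h r s + (single_edge p v r s + single_edge v q r s)"
          unfolding wg h_def by simp
        also have "h r s = b r s + b s r + single_edge p q r s"
          unfolding a(1)[symmetric] ab arc_edge[OF pqV(3)] by simp
        finally have "w r s = b r s + b s r + (single_edge p v r s + single_edge v q r s)" by simp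
        then show ?thesis unfolding d_def using pqV arc_edge[of p v r s] arc_edge[of v q r s] by simp
      qed
      moreover have "(\<Sum>u\<in>V. d r u) = (\<Sum>u\<in>V. d u r)" if "r \<in> V" for r
      proof -
        have "(\<Sum>u\<in>V. b r u) + of_bool (r = p) = (\<Sum>u\<in>V. b u r) + of_bool (r = q)"
          using a(2)[OF that] pqV unfolding ab sum.distrib by (simp add: arc_out arc_in)
        then show ?thesis unfolding d_def sum.distrib using pqV vx by (simp add: arc_out arc_in)
      qed
      ultimately show ?thesis by blast
    qed
  qed
qed

text \<open>For symmetric \<open>c\<close>, both arcs of a digon are exchanged or both are kept.\<close>

definition reorient :: "('a \<Rightarrow> 'a \<Rightarrow> bool) \<Rightarrow> ('a \<times> 'a) set \<Rightarrow> ('a \<times> 'a) set" where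
  "reorient c H = {(u, v). (u, v) \<in> H \<and> \<not> c u v \<or> (v, u) \<in> H \<and> c v u}"

text \<open>The underlying multigraph, which translates \<open>edge_connected\<close> into
  \<open>econn\<close>.\<close>

definition arc_mult :: "('a \<times> 'a) set \<Rightarrow> 'a \<Rightarrow> 'a \<Rightarrow> nat" where
  "arc_mult H = (\<lambda>u v. of_bool ((u, v) \<in> H) + of_bool ((v, u) \<in> H))"

section \<open>From digraphs to multigraphs and back to an arc-strong reorientation\<close>

lemma arcs_from_to_sum:
  assumes "finite X" "finite Y"
  shows "arcs_from_to H X Y = (\<Sum>u\<in>X. \<Sum>v\<in>Y. of_bool ((u, v) \<in> H))"
proof -
  have "{(u, v) \<in> H. u \<in> X \<and> v \<in> Y} = {p \<in> X \<times> Y. p \<in> H}" by auto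
  then have "arcs_from_to H X Y = (\<Sum>p\<in>X \<times> Y. of_bool (p \<in> H))"
    unfolding arcs_from_to_def using assms by (simp add: sum_of_bool_eq Int_def)
  also have "\<dots> = (\<Sum>u\<in>X. \<Sum>v\<in>Y. of_bool ((u, v) \<in> H))"
    by (simp add: sum.cartesian_product case_prod_unfold)
  finally show ?thesis .
qed

lemma mgraph_arc_mult: "digraph_on n H \<Longrightarrow> mgraph {..<n} (arc_mult H)"
  unfolding digraph_on_def mgraph_def arc_mult_def by auto

lemma cut_arc_mult:
  assumes "X \<subseteq> {..<n}"
  shows "cut_size {..<n} (arc_mult H) X = arcs_from_to H X ({..<n} - X) + arcs_from_to H ({..<n} - X) X"
proof -
  have fin: "finite X" "finite ({..<n} - X)" using assms finite_subset by auto
  have "arcs_from_to H ({..<n} - X) X = (\<Sum>v\<in>X. \<Sum>u\<in>{..<n} - X. of_bool ((u, v) \<in> H))"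
    unfolding arcs_from_to_sum[OF fin(2,1)] by (rule sum.swap)
  then show ?thesis
    unfolding cut_size_def arc_mult_def arcs_from_to_sum[OF fin] sum.distrib by simp
qed

lemma cut_cases:
  assumes "V1 \<inter> V2 = {}" "V1 \<union> V2 = {..<n::nat}" "V1 \<noteq> {}" "V2 \<noteq> {}"
  shows "V1 \<subset> {..<n}" "V2 = {..<n} - V1"
  using assms by auto

lemma edge_connected_iff_econn: "edge_connected m n H \<longleftrightarrow> econn m {..<n} (arc_mult H)"
proof
  assume H: "edge_connected m n H"
  show "econn m {..<n} (arc_mult H)"
    unfolding econn_def
  proof (intro allI impI)
    fix X assume X: "X \<subset> {..<n} \<and> X \<noteq> {}"
    have "X \<inter> ({..<n} - X) = {} \<and> X \<union> ({..<n} - X) = {..<n} \<and> X \<noteq> {} \<and> {..<n} - X \<noteq> {}" using X by blast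
    then have "m \<le> arcs_from_to H X ({..<n} - X) + arcs_from_to H ({..<n} - X) X"
      using H unfolding edge_connected_def by blast
    then show "m \<le> cut_size {..<n} (arc_mult H) X" using cut_arc_mult[of X n H] X by (simp add: psubset_imp_subset)
  qed
next
  assume e: "econn m {..<n} (arc_mult H)"
  show "edge_connected m n H"
    unfolding edge_connected_def
  proof (intro allI impI)
    fix V1 V2 assume V: "V1 \<inter> V2 = {} \<and> V1 \<union> V2 = {..<n} \<and> V1 \<noteq> {} \<and> V2 \<noteq> {}"
    then have c: "V1 \<subset> {..<n}" "V2 = {..<n} - V1" using cut_cases[of V1 V2 n] by simp_all
    have "m \<le> cut_size {..<n} (arc_mult H) V1" using e V c(1) unfolding econn_def by blast
    then show "m \<le> arcs_from_to H V1 V2 + arcs_from_to H V2 V1"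
      using cut_arc_mult[OF psubset_imp_subset[OF c(1)], of H] c(2) by simp
  qed
qed

text \<open>The underlying graph splits into single edges \<open>es\<close> and digons counted
  twice, so \<open>es\<close> plus the demand graph has even degrees. An Eulerian orientation of it
  tells which single arcs to reverse; each digon gives one arc in either direction.\<close>

theorem ex_k_arc_strong_reorientation:
  assumes D: "digraph_on n H" and conn: "edge_connected (2 * k) n H" and k: "1 \<le> k"
  shows "\<exists>c. (\<forall>u v. c u v = c v u) \<and> k_arc_strong k n (reorient c H)"
proof -
  let ?V = "{..<n}"
  define e where "e = arc_mult H"
  have e: "mgraph ?V e" unfolding e_def using mgraph_arc_mult[OF D] .
  have loop: "(v, v) \<notin> H" for v using D unfolding digraph_on_def by blast
  define es :: "nat \<Rightarrow> nat \<Rightarrow> nat" where "es u v = of_bool (((u, v) \<in> H) \<noteq> ((v, u) \<in> H))" for u v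
  define dg :: "nat \<Rightarrow> nat \<Rightarrow> nat" where "dg u v = of_bool ((u, v) \<in> H \<and> (v, u) \<in> H)" for u v
  have e_split: "e = (\<lambda>u v. es u v + (dg u v + dg u v))"
    unfolding e_def arc_mult_def es_def dg_def by (intro ext) auto
  have es: "mgraph ?V es"
    using D unfolding mgraph_def es_def digraph_on_def by auto
  obtain M where M: "mgraph ?V M" "\<And>v. v \<in> ?V \<Longrightarrow> even (vdeg ?V e v + vdeg ?V M v)"
    "\<And>X. X \<subset> ?V \<Longrightarrow> X \<noteq> {} \<Longrightarrow> cut_size ?V M X + 2 * k \<le> cut_size ?V e X"
    using ex_pairing[OF e, of "2 * k"] conn k unfolding edge_connected_iff_econn e_def[symmetric] by auto
  define w where "w = (\<lambda>u v. es u v + M u v)"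
  have w: "mgraph ?V w" unfolding w_def by (rule mgraph_add[OF es M(1)])
  have "even (vdeg ?V w v)" if "v \<in> ?V" for v
    using M(2)[OF that] unfolding w_def e_split deg_add by simp
  then obtain a where a: "\<And>u v. a u v + a v u = w u v"
    "\<And>v. v \<in> ?V \<Longrightarrow> (\<Sum>u\<in>?V. a v u) = (\<Sum>u\<in>?V. a u v)"
    using ex_eulerian_orientation[OF w] by blast
  \<comment> \<open>A single arc is reversed only if the Eulerian orientation has no copy in its
    direction. Then every single arc of \<open>R\<close> uses up one oriented copy.\<close>
  define c where "c u v \<longleftrightarrow> (u, v) \<in> H \<and> (v, u) \<notin> H \<and> a u v = 0 \<or> (v, u) \<in> H \<and> (u, v) \<notin> H \<and> a v u = 0" for u v
  define R where "R = reorient c H"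
  define os :: "nat \<Rightarrow> nat \<Rightarrow> nat" where "os u v = of_bool ((u, v) \<in> R \<and> es u v = 1)" for u v
  have R_iff: "(u, v) \<in> R \<longleftrightarrow> (u, v) \<in> H \<and> \<not> c u v \<or> (v, u) \<in> H \<and> c v u" for u v
    unfolding R_def reorient_def by simp
  have pos: "1 \<le> a u v + a v u" if "es u v = 1" for u v unfolding a(1) w_def using that by simp
  have os_le: "os u v \<le> a u v" for u v
    using pos[of u v] unfolding os_def R_iff c_def es_def by (auto simp: of_bool_def split: if_splits)
  have os_sum: "os u v + os v u = es u v" for u v
    using pos[of u v] unfolding os_def R_iff c_def es_def by (auto simp: of_bool_def split: if_splits)
  have R_split: "of_bool ((u, v) \<in> R) \<ge> os u v + dg u v" for u v
    unfolding os_def R_iff c_def es_def dg_def by (auto simp: of_bool_def split: if_splits)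
  define m where "m u v = a u v - os u v" for u v
  have am: "a u v = os u v + m u v" for u v unfolding m_def using os_le by simp
  have m_sum: "m u v + m v u = M u v" for u v
    using a(1)[of u v] os_sum[of u v] unfolding w_def am by linarith
  have "k \<le> arcs_from_to R X (?V - X)" if X: "X \<subset> ?V" "X \<noteq> {}" for X
  proof -
    have fin: "finite X" "finite (?V - X)" using X finite_subset[of X ?V] by auto
    define S where "S f = (\<Sum>u\<in>X. \<Sum>v\<in>?V - X. f u v :: nat)" for f
    have S_add: "S (\<lambda>u v. f u v + g u v) = S f + S g" for f g unfolding S_def by (simp add: sum.distrib)
    have S_cut: "cut_size ?V f X = S f" for f unfolding cut_size_def S_def by simp
    have "(\<Sum>u\<in>X. \<Sum>v\<in>?V. a u v) = (\<Sum>u\<in>X. \<Sum>v\<in>?V. a v u)" by (rule sum.cong[OF refl], rule a(2)) (use X in blast)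
    moreover have "(\<Sum>u\<in>X. \<Sum>v\<in>?V. f u v) = S f + (\<Sum>u\<in>X. \<Sum>v\<in>X. f u v)" for f :: "nat \<Rightarrow> nat \<Rightarrow> nat"
    proof -
      have "(\<Sum>v\<in>?V. f u v) = (\<Sum>v\<in>?V - X. f u v) + (\<Sum>v\<in>X. f u v)" for u
        using X by (intro sum.subset_diff) auto
      then show ?thesis unfolding S_def by (simp add: sum.distrib)
    qed
    moreover have "(\<Sum>u\<in>X. \<Sum>v\<in>X. a u v) = (\<Sum>u\<in>X. \<Sum>v\<in>X. a v u)" by (rule sum.swap)
    ultimately have "S a = S (\<lambda>u v. a v u)" by simp
    then have bal: "S os + S m = S (\<lambda>u v. os v u) + S (\<lambda>u v. m v u)"
      unfolding am S_add .
    have s1: "S os + S (\<lambda>u v. os v u) = S es" unfolding S_add[symmetric] os_sum ..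
    have s2: "S m + S (\<lambda>u v. m v u) = S M" unfolding S_add[symmetric] m_sum ..
    have s3: "S e = S es + (S dg + S dg)" unfolding e_split S_add ..
    \<comment> \<open>Balance gives \<open>2 * (S os + S m) = S es + S M\<close>, and
      \<open>S m \<le> S M\<close>; so \<open>2 * (S os + S dg)\<close> is at least
      \<open>S e - S M\<close>, hence at least \<open>2 * k\<close>.\<close>
    have "S os + S dg \<le> arcs_from_to R X (?V - X)"
      unfolding arcs_from_to_sum[OF fin] S_add[symmetric] unfolding S_def by (intro sum_mono R_split)
    moreover have "S M + 2 * k \<le> S e" using M(3)[OF X] unfolding S_cut .
    ultimately show ?thesis using bal s1 s2 s3 by linarith
  qed
  then have "k_arc_strong k n R"
    unfolding k_arc_strong_def using cut_cases by (metis (no_types, lifting))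
  moreover have "c u v = c v u" for u v unfolding c_def by blast
  ultimately show ?thesis unfolding R_def by blast
qed

section \<open>Vectors over the two-element field\<close>

text \<open>Vectors are sets of coordinates; the scalar product of \<open>A\<close> and \<open>B\<close> is the parity of
  \<open>card (A \<inter> B)\<close>, and \<open>xsum\<close> is a sum of vectors.\<close>

definition xsum :: "('a \<Rightarrow> nat set) \<Rightarrow> 'a set \<Rightarrow> nat set" where
  "xsum g F = {j. odd (card {u \<in> F. j \<in> g u})}"

text \<open>Coefficients are 0 or 1, so a linear combination is a subset of the index set; equal
  vectors at distinct indices count as dependent.\<close>

definition indep :: "('a \<Rightarrow> nat set) \<Rightarrow> 'a set \<Rightarrow> bool" where
  "indep g S \<longleftrightarrow> (\<forall>F. F \<subseteq> S \<and> F \<noteq> {} \<longrightarrow> xsum g F \<noteq> {})"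

definition xspan :: "('a \<Rightarrow> nat set) \<Rightarrow> 'a set \<Rightarrow> nat set set" where
  "xspan g S = xsum g ` Pow S"

lemma xsum_cong:
  assumes "\<And>u. u \<in> F \<Longrightarrow> g u = h u"
  shows "xsum g F = xsum h F"
proof -
  have "{u \<in> F. j \<in> g u} = {u \<in> F. j \<in> h u}" for j using assms by auto
  then show ?thesis unfolding xsum_def by simp
qed

lemma xsum_empty [simp]: "xsum g {} = {}"
  unfolding xsum_def by simp

lemma finite_xspan: "finite S \<Longrightarrow> finite (xspan g S)"
  unfolding xspan_def by simp

lemma card_xspan_le: "finite S \<Longrightarrow> card (xspan g S) \<le> 2 ^ card S"
  unfolding xspan_def by (metis card_Pow card_image_le finite_Pow_iff)

lemma xspan_mono: "S \<subseteq> S' \<Longrightarrow> xspan g S \<subseteq> xspan g S'"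
  unfolding xspan_def by blast

lemma empty_in_xspan: "{} \<in> xspan g S"
  unfolding xspan_def using xsum_empty by (metis Pow_bottom image_eqI)

text \<open>Characteristic 2: a relation through \<open>x\<close> expresses \<open>g x\<close> by
  the others. Hence choosing \<open>g x\<close> outside a span preserves independence.\<close>

lemma xsum_insert_empty_iff:
  assumes "finite F" "x \<notin> F"
  shows "xsum g (insert x F) = {} \<longleftrightarrow> g x = xsum g F"
proof -
  have "card {u \<in> insert x F. j \<in> g u} = card {u \<in> F. j \<in> g u} + of_bool (j \<in> g x)" for j
  proof (cases "j \<in> g x")
    case True
    then have "{u \<in> insert x F. j \<in> g u} = insert x {u \<in> F. j \<in> g u}" by auto
    then show ?thesis using assms True by simp
  next
    case False
    then have "{u \<in> insert x F. j \<in> g u} = {u \<in> F. j \<in> g u}" by auto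
    then show ?thesis using False by simp
  qed
  then have "j \<in> xsum g (insert x F) \<longleftrightarrow> (j \<in> xsum g F) \<noteq> (j \<in> g x)" for j
    unfolding xsum_def by auto
  then show ?thesis by blast
qed

text \<open>Additivity of the scalar product in its second argument.\<close>

lemma even_sum_card_Int:
  assumes "finite F" "finite a"
  shows "even (\<Sum>u\<in>F. card (a \<inter> g u)) \<longleftrightarrow> even (card (a \<inter> xsum g F))"
proof -
  have "(\<Sum>u\<in>F. card (a \<inter> g u)) = (\<Sum>u\<in>F. \<Sum>j\<in>a. of_bool (j \<in> g u))"
    using assms by (simp add: sum_of_bool_eq Int_def)
  also have "\<dots> = (\<Sum>j\<in>a. \<Sum>u\<in>F. of_bool (j \<in> g u))" by (rule sum.swap)
  also have "\<dots> = (\<Sum>j\<in>a. card {u \<in> F. j \<in> g u})"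
    using assms by (simp add: sum_of_bool_eq Int_def)
  finally have "even (\<Sum>u\<in>F. card (a \<inter> g u)) \<longleftrightarrow> even (card {j \<in> a. odd (card {u \<in> F. j \<in> g u})})"
    using assms by (simp add: even_sum_iff)
  moreover have "{j \<in> a. odd (card {u \<in> F. j \<in> g u})} = a \<inter> xsum g F" unfolding xsum_def by auto
  ultimately show ?thesis by simp
qed

text \<open>The sum factorises over the coordinates in \<open>T\<close>; a coordinate in
  \<open>h\<close> contributes the factor 0, any other the factor 2.\<close>

lemma sum_sign_Pow:
  assumes "finite T"
  shows "(\<Sum>a\<in>Pow T. (-1) ^ card (a \<inter> h)) = (if T \<inter> h = {} then 2 ^ card T else (0::int))"
proof -
  have "(\<Prod>j\<in>a. if j \<in> h then - 1 else 1) = ((- 1) ^ card (a \<inter> h) :: int)" if "a \<subseteq> T" for a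
    using finite_subset[OF that assms] by (simp add: prod.If_cases Int_commute)
  then have "(\<Sum>a\<in>Pow T. (-1) ^ card (a \<inter> h)) = (\<Sum>a\<in>Pow T. (\<Prod>j\<in>a. if j \<in> h then - 1 else (1::int)) * (\<Prod>j\<in>T - a. 1))"
    by (intro sum.cong) auto
  also have "\<dots> = (\<Prod>j\<in>T. (if j \<in> h then - 1 else 1) + 1)"
    using assms by (simp add: prod_add)
  also have "\<dots> = (if T \<inter> h = {} then 2 ^ card T else 0)"
  proof (cases "T \<inter> h = {}")
    case True
    then have "(\<Prod>j\<in>T. (if j \<in> h then - 1 else 1) + 1) = (\<Prod>j\<in>T. 2 :: int)" by (intro prod.cong) auto
    then show ?thesis using True by simp
  next
    case False
    then show ?thesis using assms by (auto intro!: prod_zero)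
  qed
  finally show ?thesis .
qed

text \<open>Character sum: only the trivial relation among independent vectors contributes.\<close>
lemma card_solutions_indep:
  assumes T: "finite T" and S: "finite S" and g: "\<And>u. u \<in> S \<Longrightarrow> g u \<subseteq> T" and ind: "indep g S"
  shows "card {a \<in> Pow T. \<forall>u\<in>S. odd (card (g u \<inter> a)) \<longleftrightarrow> c u} * 2 ^ card S = 2 ^ card T"
proof -
  define sol where "sol = {a \<in> Pow T. \<forall>u\<in>S. odd (card (g u \<inter> a)) \<longleftrightarrow> c u}"
  define chi :: "nat set \<Rightarrow> 'a \<Rightarrow> int" where "chi a u = (-1) ^ (card (a \<inter> g u) + of_bool (c u))" for a u
  have chi1: "chi a u = (if odd (card (g u \<inter> a)) \<longleftrightarrow> c u then 1 else -1)" for a u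
    unfolding chi_def by (simp add: Int_commute uminus_power_if)
  \<comment> \<open>\<open>chi a u\<close> is 1 if \<open>a\<close> solves the equation at
    \<open>u\<close> and -1 otherwise, so the product detects solutions. Expanding it over subsets
    of \<open>S\<close> leads to character sums.\<close>
  have ind_sol: "(\<Prod>u\<in>S. chi a u + 1) = (if a \<in> sol then 2 ^ card S else 0)" if aT: "a \<in> Pow T" for a
  proof (cases "a \<in> sol")
    case True
    then have "(\<Prod>u\<in>S. chi a u + 1) = (\<Prod>u\<in>S. 2)" unfolding sol_def chi1 by (intro prod.cong) auto
    then show ?thesis using True by simp
  next
    case False
    then obtain u where u: "u \<in> S" "(odd (card (g u \<inter> a)) \<longleftrightarrow> c u) = False" using aT unfolding sol_def by blast
    then have "chi a u = -1" unfolding chi1 by (simp only: if_False)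
    then have "\<exists>u\<in>S. chi a u + 1 = 0" using u(1) by (intro bexI[of _ u]) simp_all
    then have "(\<Prod>u\<in>S. chi a u + 1) = 0" using S by (intro prod_zero)
    then show ?thesis using False by simp
  qed
  have prod_chi: "(\<Prod>u\<in>F. chi a u) = (-1) ^ card (a \<inter> xsum g F) * (-1) ^ (\<Sum>u\<in>F. of_bool (c u))"
    if "F \<subseteq> S" "a \<subseteq> T" for F a
  proof -
    have fin: "finite F" "finite a" using that S T finite_subset by auto
    have "(\<Prod>u\<in>F. chi a u) = (-1) ^ (\<Sum>u\<in>F. card (a \<inter> g u)) * (-1) ^ (\<Sum>u\<in>F. of_bool (c u))"
      unfolding chi_def power_add prod.distrib power_sum ..
    moreover have "((-1) ^ (\<Sum>u\<in>F. card (a \<inter> g u)) :: int) = (-1) ^ card (a \<inter> xsum g F)"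
      using even_sum_card_Int[OF fin, of g] by (simp add: uminus_power_if)
    ultimately show ?thesis by simp
  qed
  have "finite sol" unfolding sol_def using T by simp
  have "int (card sol * 2 ^ card S) = (\<Sum>a\<in>Pow T. if a \<in> sol then 2 ^ card S else 0)"
  proof -
    have "Pow T \<inter> sol = sol" unfolding sol_def by auto
    then show ?thesis using T by (simp add: sum.If_cases)
  qed
  also have "\<dots> = (\<Sum>a\<in>Pow T. \<Prod>u\<in>S. chi a u + 1)" using ind_sol by (intro sum.cong) auto
  also have "\<dots> = (\<Sum>a\<in>Pow T. \<Sum>F\<in>Pow S. \<Prod>u\<in>F. chi a u)" using S by (simp add: prod_add)
  also have "\<dots> = (\<Sum>F\<in>Pow S. \<Sum>a\<in>Pow T. \<Prod>u\<in>F. chi a u)" by (rule sum.swap)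
  also have "\<dots> = (\<Sum>F\<in>Pow S. if F = {} then 2 ^ card T else 0)"
  proof (intro sum.cong refl)
    fix F assume F: "F \<in> Pow S"
    have "(\<Sum>a\<in>Pow T. \<Prod>u\<in>F. chi a u) = (\<Sum>a\<in>Pow T. (-1) ^ card (a \<inter> xsum g F)) * (-1) ^ (\<Sum>u\<in>F. of_bool (c u))"
      using F prod_chi by (simp add: sum_distrib_right)
    also have "\<dots> = (if F = {} then 2 ^ card T else 0)"
    proof (cases "F = {}")
      case True
      then show ?thesis using sum_sign_Pow[OF T, of "{}"] T by (simp add: card_Pow)
    next
      case False
      have "xsum g F \<subseteq> T"
      proof
        fix j assume "j \<in> xsum g F"
        then have "{u \<in> F. j \<in> g u} \<noteq> {}" unfolding xsum_def by (metis (mono_tags, lifting) card.empty even_zero mem_Collect_eq)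
        then show "j \<in> T" using F g by blast
      qed
      moreover have "xsum g F \<noteq> {}" using ind False F unfolding indep_def by blast
      ultimately have "T \<inter> xsum g F \<noteq> {}" by blast
      then show ?thesis using sum_sign_Pow[OF T, of "xsum g F"] False by simp
    qed
    finally show "(\<Sum>a\<in>Pow T. \<Prod>u\<in>F. chi a u) = (if F = {} then 2 ^ card T else 0)" .
  qed
  also have "\<dots> = 2 ^ card T"
  proof -
    have "Pow S \<inter> {F. F = {}} = {{}}" by auto
    then show ?thesis using S by (simp add: sum.If_cases)
  qed
  finally have "int (card sol * 2 ^ card S) = int (2 ^ card T)" by simp
  then show ?thesis unfolding sol_def by linarith
qed

section \<open>Greedy choice of vectors with prescribed scalar products\<close>

text \<open>Vertices are treated in the order of \<open>rk\<close>; for every \<open>w\<close>,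
  treated or not, the vectors of the treated members of \<open>nb w\<close> stay independent. Thus
  \<open>card_solutions_indep\<close> counts the candidates at \<open>x\<close>, and
  \<open>bad\<close> says that the spans to be avoided do not exhaust them.\<close>

lemma greedy_assignment:
  fixes rk :: "'a \<Rightarrow> 'b::linorder" and T :: "nat set"
  assumes V: "finite V" and T: "finite T" and inj: "inj_on rk V"
    and nb: "\<And>x. x \<in> V \<Longrightarrow> nb x \<subseteq> {u \<in> V. rk u < rk x}"
    and bad: "\<And>x g. x \<in> V \<Longrightarrow>
      card (\<Union>w\<in>{w \<in> V. x \<in> nb w}. xspan g {u \<in> nb w. rk u < rk x}) * 2 ^ card (nb x) < 2 ^ card T"
  shows "\<exists>g. (\<forall>v\<in>V. g v \<subseteq> T) \<and> (\<forall>v\<in>V. \<forall>u\<in>nb v. odd (card (g u \<inter> g v)) \<longleftrightarrow> c u v)"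
proof -
  have finnb: "finite (nb x)" if "x \<in> V" for x
    by (rule finite_subset[OF nb[OF that]]) (simp add: V)
  have "\<exists>g. (\<forall>v\<in>U. g v \<subseteq> T) \<and> (\<forall>v\<in>U. \<forall>u\<in>nb v. odd (card (g u \<inter> g v)) \<longleftrightarrow> c u v)
      \<and> (\<forall>w\<in>V. indep g (nb w \<inter> U))"
    if "U \<subseteq> V" "\<forall>u\<in>V. \<forall>v\<in>U. rk u < rk v \<longrightarrow> u \<in> U" for U
    using that
  proof (induction "card U" arbitrary: U)
    case 0
    then have "U = {}" using V finite_subset card_0_eq by metis
    then show ?case by (auto simp: indep_def)
  next
    case (Suc n)
    have finU: "finite U" using Suc.prems V finite_subset by auto
    have "U \<noteq> {}" using Suc.hyps(2) by auto
    \<comment> \<open>\<open>x\<close> is the last vertex of the initial segment \<open>U\<close>;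
      its equations involve only vertices already treated.\<close>
    have "Max (rk ` U) \<in> rk ` U" using finU \<open>U \<noteq> {}\<close> by simp
    then obtain x where x: "x \<in> U" "rk x = Max (rk ` U)" by auto
    have le: "rk u \<le> rk x" if "u \<in> U" for u using that finU x by simp
    have xV: "x \<in> V" using x Suc.prems by auto
    define U' where "U' = U - {x}"
    have U': "U = insert x U'" "x \<notin> U'" using x unfolding U'_def by auto
    have lt: "rk u < rk x" if "u \<in> U'" for u
      using le[of u] that inj Suc.prems(1) x U' unfolding inj_on_def
      by (metis insertCI le_neq_trans subsetD)
    have inU': "u \<in> U'" if "u \<in> V" "rk u < rk x" for u
      using Suc.prems(2) that x U' by (metis insertE less_irrefl)
    have "n = card U'" using Suc.hyps(2) U' finU by simp
    moreover have "U' \<subseteq> V" using Suc.prems U' by auto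
    moreover have "\<forall>u\<in>V. \<forall>v\<in>U'. rk u < rk v \<longrightarrow> u \<in> U'" using inU' lt by (meson less_trans)
    ultimately obtain g where g: "\<forall>v\<in>U'. g v \<subseteq> T" "\<forall>v\<in>U'. \<forall>u\<in>nb v. odd (card (g u \<inter> g v)) \<longleftrightarrow> c u v"
      "\<forall>w\<in>V. indep g (nb w \<inter> U')"
      using Suc.hyps(1)[of U'] by blast
    have nbx: "nb x \<subseteq> U'" using nb[OF xV] inU' by blast
    have before: "{u \<in> nb w. rk u < rk x} = nb w \<inter> U'" if "w \<in> V" for w
      using inU' lt nb[OF that] by blast
    define sol where "sol = {a \<in> Pow T. \<forall>u\<in>nb x. odd (card (g u \<inter> a)) \<longleftrightarrow> c u x}"
    \<comment> \<open>The values of \<open>g x\<close> that create a relation among earlier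
      neighbours of a vertex \<open>w\<close> still to come.\<close>
    define B where "B = (\<Union>w\<in>{w \<in> V. x \<in> nb w}. xspan g {u \<in> nb w. rk u < rk x})"
    have "card sol * 2 ^ card (nb x) = 2 ^ card T"
      unfolding sol_def using g nbx xV finnb[OF xV] T
      by (intro card_solutions_indep) (auto simp: Int_absorb2)
    then have "card B * 2 ^ card (nb x) < card sol * 2 ^ card (nb x)"
      using bad[OF xV, of g] unfolding B_def by simp
    then have "card B < card sol" by simp
    moreover have "finite B" unfolding B_def using V finnb by (auto intro!: finite_xspan)
    ultimately have "\<not> sol \<subseteq> B" using card_mono by (metis not_less)
    then obtain a where a: "a \<in> sol" "a \<notin> B" by blast
    define h where "h = g(x := a)"
    have hg: "h u = g u" if "u \<in> U'" for u using that U' unfolding h_def by auto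
    have nbU: "nb v \<subseteq> U'" if "v \<in> U" for v
    proof (cases "v = x")
      case True then show ?thesis using nbx by simp
    next
      case False
      then have "v \<in> U'" using that U' by auto
      then show ?thesis using nb[of v] lt inU' Suc.prems(1) that by (smt (verit) less_trans mem_Collect_eq subset_iff)
    qed
    have "h v \<subseteq> T" if "v \<in> U" for v using that g(1) a U' unfolding h_def sol_def by auto
    moreover have "odd (card (h u \<inter> h v)) \<longleftrightarrow> c u v" if "v \<in> U" "u \<in> nb v" for u v
    proof -
      have u: "h u = g u" using hg nbU that by blast
      show ?thesis
      proof (cases "v = x")
        case True
        then show ?thesis using a that u unfolding sol_def h_def by simp
      next
        case False
        then show ?thesis using g(2) that u hg U' by auto
      qed
    qed
    moreover have "indep h (nb w \<inter> U)" if w: "w \<in> V" for w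
      unfolding indep_def
    proof (intro allI impI)
      fix F assume F: "F \<subseteq> nb w \<inter> U \<and> F \<noteq> {}"
      show "xsum h F \<noteq> {}"
      proof (cases "x \<in> F")
        case False
        then have "F \<subseteq> nb w \<inter> U'" using F U' by auto
        moreover have "xsum h F = xsum g F" using calculation hg by (intro xsum_cong) auto
        ultimately show ?thesis using g(3) w F unfolding indep_def by auto
      next
        case True
        define F' where "F' = F - {x}"
        have F': "F = insert x F'" "x \<notin> F'" "F' \<subseteq> nb w \<inter> U'" using True F U' unfolding F'_def by auto
        have "finite F'" using F' finU U' by (meson finite_insert finite_subset le_inf_iff)
        have "xsum g F' \<in> B"
          unfolding B_def xspan_def using before[OF w] F' True F w by blast
        moreover have "xsum h F' = xsum g F'" using F' hg by (intro xsum_cong) auto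
        ultimately have "h x \<noteq> xsum h F'" using a unfolding h_def by auto
        then show ?thesis using xsum_insert_empty_iff[OF \<open>finite F'\<close> F'(2), of h] F'(1) by simp
      qed
    qed
    ultimately show ?case by blast
  qed
  from this[of V] show ?thesis by auto
qed

section \<open>Counting forbidden vectors by means of tight sets\<close>

lemma card_le_sum_pos:
  assumes "finite S" "\<And>v. v \<in> S \<Longrightarrow> 0 < (f v :: nat)"
  shows "card S \<le> (\<Sum>v\<in>S. f v)"
proof -
  have "(\<Sum>v\<in>S. 1) \<le> (\<Sum>v\<in>S. f v)" using assms(2) by (intro sum_mono) (simp add: Suc_leI)
  then show ?thesis by simp
qed

text \<open>Here \<gamma> counts the edges from \<open>x\<close> out of \<open>Z x\<close>, \<delta>
  its earlier neighbours and \<beta> its later neighbours outside \<open>Z x\<close>. If \<beta> is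
  positive, \<open>\<beta> \<le> 2 ^ (\<beta> - 1)\<close> keeps both summands within half of the
  bound.\<close>

lemma span_bound_arith:
  fixes K \<gamma> \<delta> \<beta> :: nat
  assumes "\<delta> + \<beta> \<le> \<gamma>" "\<gamma> \<le> K" "2 \<le> K"
  shows "(2 ^ (K - \<gamma>) + \<beta> * 2 ^ (K - 1)) * 2 ^ \<delta> < (2::nat) ^ (2 * K - 1)"
proof (cases "\<beta> = 0")
  case True
  have "(2::nat) ^ (K - \<gamma>) * 2 ^ \<delta> = 2 ^ (K - \<gamma> + \<delta>)" by (simp add: power_add)
  also have "\<dots> \<le> 2 ^ K" using assms by (intro power_increasing) auto
  also have "\<dots> < 2 ^ (2 * K - 1)" using assms by (intro power_strict_increasing) auto
  finally show ?thesis using True by simp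
next
  case False
  have "(2::nat) ^ (K - \<gamma>) * 2 ^ \<delta> = 2 ^ (K - \<gamma> + \<delta>)" by (simp add: power_add)
  also have "\<dots> \<le> 2 ^ (K - 1)" using assms False by (intro power_increasing) auto
  also have "\<dots> < 2 ^ (2 * K - 2)" using assms by (intro power_strict_increasing) auto
  finally have 1: "(2::nat) ^ (K - \<gamma>) * 2 ^ \<delta> < 2 ^ (2 * K - 2)" .
  have "\<beta> - 1 < 2 ^ (\<beta> - 1)" by (rule less_exp)
  then have "\<beta> \<le> 2 ^ (\<beta> - 1)" by linarith
  then have "\<beta> * 2 ^ (K - 1) * 2 ^ \<delta> \<le> 2 ^ (\<beta> - 1) * 2 ^ (K - 1) * 2 ^ \<delta>" by simp
  also have "\<dots> = 2 ^ ((\<beta> - 1) + (K - 1) + \<delta>)" by (simp add: power_add)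
  also have "\<dots> \<le> 2 ^ (2 * K - 2)" using assms False by (intro power_increasing) auto
  finally have 2: "\<beta> * 2 ^ (K - 1) * 2 ^ \<delta> \<le> 2 ^ (2 * K - 2)" .
  have "Suc (2 * K - 2) = 2 * K - 1" using assms by simp
  then have "(2::nat) ^ (2 * K - 1) = 2 * 2 ^ (2 * K - 2)" by (metis power_Suc)
  then show ?thesis using 1 2 by (simp add: distrib_right)
qed

text \<open>As \<open>r\<close> lies outside both sets, the union is proper and its cut is at least
  \<open>K\<close>; submodularity leaves no more than \<open>K\<close> for the intersection.\<close>

lemma tight_Int:
  assumes e: "mgraph V e" and conn: "econn K V e" and r: "r \<in> V"
    and X: "X \<subset> V" "cut_size V e X = K" "r \<notin> X" and Y: "Y \<subset> V" "cut_size V e Y = K" "r \<notin> Y"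
    and ne: "X \<inter> Y \<noteq> {}"
  shows "cut_size V e (X \<inter> Y) = K"
proof -
  have "X \<inter> Y \<subset> V" "X \<union> Y \<subset> V" "X \<union> Y \<noteq> {}" using X Y ne r by blast+
  then have "K \<le> cut_size V e (X \<inter> Y)" "K \<le> cut_size V e (X \<union> Y)"
    using conn ne unfolding econn_def by blast+
  moreover have "cut_size V e (X \<inter> Y) + cut_size V e (X \<union> Y) \<le> K + K"
    using cut_submodular[OF mgraph_finite[OF e], of X Y e] X Y by (simp add: psubset_imp_subset)
  ultimately show ?thesis by linarith
qed

text \<open>The two conditions on \<open>t\<close> serve two kinds of vertices: the first those
  without earlier neighbours, where nothing better than \<open>card V\<close> bounds the later ones;
  the second all others, where the tight cut of \<open>Z x\<close> limits the forbidden
  vectors.\<close>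

lemma ex_realising_vectors:
  fixes V :: "'a::linorder set"
  assumes e: "mgraph V e" and conn: "econn K V e" and K: "2 \<le> K"
    and crit: "\<And>x y. 0 < e x y \<Longrightarrow> \<exists>X. X \<subset> V \<and> X \<noteq> {} \<and> cut_size V e X = K \<and> x \<in> X \<and> y \<notin> X"
    and V: "V \<noteq> {}" and t: "card V * (2 ^ (K - 1) - 1) < 2 ^ t" "2 * K - 1 \<le> t"
    and c: "\<And>u v. c u v = c v u"
  shows "\<exists>g. (\<forall>v\<in>V. g v \<subseteq> {..<t}) \<and> (\<forall>u v. 0 < e u v \<longrightarrow> (odd (card (g u \<inter> g v)) \<longleftrightarrow> c u v))"
proof -
  have fin: "finite V" using e by (rule mgraph_finite)
  have inV: "u \<in> V" "v \<in> V" if "0 < e u v" for u v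
    using that mgraph_outside[OF e, of u v] by (cases "u \<in> V"; cases "v \<in> V"; simp)+
  obtain r where r: "r \<in> V" using V by blast
  \<comment> \<open>tight sets around \<open>x\<close> avoiding the root; they are closed under intersection\<close>
  define av where "av x = {X. X \<subset> V \<and> cut_size V e X = K \<and> r \<notin> X \<and> x \<in> X}" for x
  have av_in: "\<Inter>(av x) \<in> av x" if "av x \<noteq> {}" for x
  proof (rule finite_Inf_in[OF _ that])
    have "av x \<subseteq> Pow V" unfolding av_def by blast
    then show "finite (av x)" using fin by (meson finite_Pow_iff finite_subset)
    fix X Y assume XY: "X \<in> av x" "Y \<in> av x"
    then have "cut_size V e (X \<inter> Y) = K"
      unfolding av_def by (intro tight_Int[OF e conn r]) blast+
    then show "inf X Y \<in> av x" using XY unfolding av_def by auto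
  qed
  \<comment> \<open>The least tight set around \<open>x\<close> avoiding \<open>r\<close>; the
    default \<open>V\<close> applies in particular to \<open>r\<close> itself.\<close>
  define Z where "Z x = (if av x = {} then V else \<Inter>(av x))" for x
  have Z_tight: "Z x \<in> av x" if "Z x \<noteq> V" for x using that av_in unfolding Z_def by auto
  have Z_sub: "Z x \<subseteq> V" for x using Z_tight[of x] unfolding av_def by blast
  have Z_self: "x \<in> Z x" if "x \<in> V" for x using Z_tight[of x] that unfolding av_def by auto
  have Z_least: "Z x \<subseteq> X" if "X \<in> av x" for x X using that unfolding Z_def by auto
  have Z_nested: "Z y \<subseteq> Z x" if "y \<in> Z x" for x y
  proof (cases "Z x = V")
    case True then show ?thesis using Z_sub by simp
  next
    case False
    then have "Z x \<in> av y" using Z_tight[OF False] that unfolding av_def by auto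
    then show ?thesis by (rule Z_least)
  qed
  have finZ: "finite (Z x)" for x using Z_sub fin finite_subset by blast
  \<comment> \<open>An edge is crossed by a tight cut; its side avoiding \<open>r\<close> contains
    one end only, so the least sets of the two ends differ.\<close>
  have class_indep: "e x y = 0" if "Z x = Z y" for x y
  proof (rule ccontr)
    assume "e x y \<noteq> 0"
    then have pos: "0 < e x y" by simp
    obtain X where X: "X \<subset> V" "cut_size V e X = K" "x \<in> X" "y \<notin> X" using crit[OF pos] by blast
    show False
    proof (cases "r \<in> X")
      case False
      then have "Z x \<subseteq> X" using X by (intro Z_least) (simp add: av_def)
      then show False using that X Z_self[OF inV(2)[OF pos]] by blast
    next
      case True
      have "cut_size V e (V - X) = K" using cut_compl[OF e, of X V] X by (simp add: psubset_imp_subset)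
      then have "V - X \<in> av y" using True X inV[OF pos] unfolding av_def by blast
      then have "Z y \<subseteq> V - X" by (rule Z_least)
      then show False using that X Z_self[OF inV(1)[OF pos]] by blast
    qed
  qed
  define \<gamma> where "\<gamma> x = (\<Sum>v\<in>V - Z x. e x v)" for x
  have \<gamma>_le: "\<gamma> x \<le> K" if "x \<in> V" for x
  proof (cases "Z x = V")
    case True then show ?thesis unfolding \<gamma>_def by simp
  next
    case False
    then have "cut_size V e (Z x) = K" using Z_tight unfolding av_def by blast
    moreover have "\<gamma> x \<le> cut_size V e (Z x)"
      unfolding cut_size_def \<gamma>_def using Z_self[OF that] finZ
      by (intro member_le_sum) auto
    ultimately show ?thesis by simp
  qed
  \<comment> \<open>the secondary key makes earlier vertices of the same class send at least as many edges out of it\<close>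
  define rk where "rk x = (card V - card (Z x), K - \<gamma> x, x)" for x
  have "inj_on rk V" unfolding rk_def inj_on_def by simp
  define nb where "nb x = {u \<in> V. rk u < rk x \<and> 0 < e u x}" for x
  \<comment> \<open>Inside \<open>Z x\<close> the sets \<open>Z u\<close> are nested in
    \<open>Z x\<close>, while an earlier \<open>u\<close> has one at least as large. So earlier
    vertices of \<open>Z x\<close> belong to the class of \<open>x\<close>, which is
    independent.\<close>
  have earlier: "Z u = Z x \<and> \<gamma> x \<le> \<gamma> u" if "u \<in> V" "x \<in> V" "rk u < rk x" "u \<in> Z x" for u x
  proof -
    have le: "card (Z u) \<le> card V" "card (Z x) \<le> card V" using Z_sub fin card_mono by blast+
    have "card V - card (Z u) \<le> card V - card (Z x)" using that(3) unfolding rk_def by auto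
    then have "card (Z x) \<le> card (Z u)" using le by linarith
    then have eq: "Z u = Z x" using Z_nested[OF that(4)] finZ by (meson card_seteq)
    then have "K - \<gamma> u \<le> K - \<gamma> x" using that(3) unfolding rk_def by auto
    then show ?thesis using eq \<gamma>_le[OF that(1)] \<gamma>_le[OF that(2)] by linarith
  qed
  have nb_out: "nb x \<subseteq> V - Z x" if "x \<in> V" for x
    using earlier[OF _ that] class_indep unfolding nb_def by fastforce
  have nbr_count: "card S \<le> \<gamma> x" if "S \<subseteq> V - Z x" "\<And>v. v \<in> S \<Longrightarrow> 0 < e x v" for S x
  proof -
    have "finite S" using that fin finite_subset by (metis finite_Diff)
    then have "card S \<le> (\<Sum>v\<in>S. e x v)" using that by (intro card_le_sum_pos)
    also have "\<dots> \<le> \<gamma> x" unfolding \<gamma>_def using that fin by (intro sum_mono2) auto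
    finally show ?thesis .
  qed
  have nb_fin: "finite (nb x)" for x unfolding nb_def using fin by simp
  have nb_card: "card (nb x) \<le> \<gamma> x" if "x \<in> V" for x
    using nb_out[OF that] mgraph_sym[OF e] by (intro nbr_count) (auto simp: nb_def)
  have "\<exists>g. (\<forall>v\<in>V. g v \<subseteq> {..<t}) \<and> (\<forall>v\<in>V. \<forall>u\<in>nb v. odd (card (g u \<inter> g v)) \<longleftrightarrow> c u v)"
  proof (rule greedy_assignment[OF fin finite_lessThan \<open>inj_on rk V\<close>])
    show "nb x \<subseteq> {u \<in> V. rk u < rk x}" for x unfolding nb_def by blast
    fix x and g :: "'a \<Rightarrow> nat set" assume x: "x \<in> V"
    define W where "W = {w \<in> V. x \<in> nb w}"
    define S where "S w = {u \<in> nb w. rk u < rk x}" for w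
    define B where "B = (\<Union>w\<in>W. xspan g (S w))"
    have S_fin: "finite (S w)" for w unfolding S_def using nb_fin by simp
    have W_fin: "finite W" unfolding W_def using fin by simp
    have S_card: "card (S w) \<le> K - 1" if "w \<in> W" for w
    proof -
      have "S w \<subseteq> nb w - {x}" unfolding S_def by auto
      then have "card (S w) \<le> card (nb w - {x})" using nb_fin by (intro card_mono) auto
      also have "\<dots> = card (nb w) - 1" using that nb_fin unfolding W_def by simp
      also have "\<dots> \<le> K - 1"
        using that nb_card[of w] \<gamma>_le[of w] unfolding W_def by auto
      finally show ?thesis .
    qed
    have span_card: "card (xspan g (S w)) \<le> 2 ^ (K - 1)" if "w \<in> W" for w
      using card_xspan_le[OF S_fin, of g w] S_card[OF that] by (meson le_trans one_le_numeral power_increasing)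
    have "card B * 2 ^ card (nb x) < 2 ^ t"
    proof (cases "nb x = {}")
      case True
      \<comment> \<open>All spans share the zero vector, so each \<open>w\<close> adds at most
        \<open>2 ^ (K - 1) - 1\<close> vectors to it. As \<open>x\<close> is not in
        \<open>W\<close>, the extra 1 still fits into \<open>card V\<close> such terms.\<close>
      have "B \<subseteq> insert {} (\<Union>w\<in>W. xspan g (S w) - {{}})" unfolding B_def by blast
      then have "card B \<le> card (insert {} (\<Union>w\<in>W. xspan g (S w) - {{}}))"
        using W_fin S_fin by (intro card_mono) (auto intro: finite_xspan)
      also have "\<dots> \<le> Suc (card (\<Union>w\<in>W. xspan g (S w) - {{}}))"
        using W_fin S_fin by (intro card_insert_le_m1 | simp add: card_insert_if finite_xspan)+
      also have "card (\<Union>w\<in>W. xspan g (S w) - {{}}) \<le> (\<Sum>w\<in>W. card (xspan g (S w) - {{}}))"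
        using W_fin by (rule card_UN_le)
      also have "(\<Sum>w\<in>W. card (xspan g (S w) - {{}})) \<le> (\<Sum>w\<in>W. 2 ^ (K - 1) - 1)"
      proof (rule sum_mono)
        fix w assume "w \<in> W"
        have "card (xspan g (S w) - {{}}) = card (xspan g (S w)) - 1"
          using empty_in_xspan finite_xspan[OF S_fin] by (intro card_Diff_singleton)
        then show "card (xspan g (S w) - {{}}) \<le> 2 ^ (K - 1) - 1" using span_card[OF \<open>w \<in> W\<close>] by linarith
      qed
      also have "\<dots> = card W * (2 ^ (K - 1) - 1)" by simp
      finally have "card B \<le> Suc (card W * (2 ^ (K - 1) - 1))" by simp
      also have "\<dots> \<le> card V * (2 ^ (K - 1) - 1)"
      proof -
        have "W \<subseteq> V - {x}" unfolding W_def nb_def by auto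
        then have "card W \<le> card V - 1" using fin x by (metis card_Diff_singleton card_mono finite_Diff)
        then have "card W + 1 \<le> card V" using fin x by (metis Suc_eq_plus1 Suc_le_eq card_gt_0_iff empty_iff le_diff_conv2 less_eq_Suc_le One_nat_def)
        then have "(card W + 1) * (2 ^ (K - 1) - 1) \<le> card V * (2 ^ (K - 1) - (1::nat))" by (rule mult_le_mono1)
        moreover have "(1::nat) \<le> 2 ^ (K - 1) - 1"
        proof -
          have "(2::nat) ^ 1 \<le> 2 ^ (K - 1)" using K by (intro power_increasing) auto
          then show ?thesis by simp
        qed
        moreover have "Suc (w * p) \<le> v * p" if "(w + 1) * p \<le> v * p" "1 \<le> p" for w v p :: nat
          using that by (simp add: add_mult_distrib)
        ultimately show ?thesis by blast
      qed
      also have "\<dots> < 2 ^ t" by (rule t(1))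
      finally show ?thesis using True by simp
    next
      case False
      \<comment> \<open>Later neighbours of \<open>x\<close> inside \<open>Z x\<close> are handled
        together: their neighbours before \<open>x\<close> lie in \<open>P\<close>, or outside
        \<open>Z x\<close> and then in \<open>Q\<close>, so one span contains all of theirs.\<close>
      define P where "P = {u \<in> Z x. rk u < rk x}"
      define Q where "Q = {u \<in> V - Z x. \<exists>w\<in>Z x - P - {x}. 0 < e w u}"
      have ZV: "Z x \<noteq> V" using False nb_out[OF x] by auto
      have fins: "finite P" "finite Q" unfolding P_def Q_def using finZ fin by simp_all
      have \<gamma>1: "1 \<le> \<gamma> x" using False nb_card[OF x] nb_fin by (metis One_nat_def Suc_leI card_gt_0_iff le_trans)
      \<comment> \<open>The \<open>K\<close> edges of the cut of \<open>Z x\<close> are shared out: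
        \<open>\<gamma> x\<close> start at \<open>x\<close>, at least one at each vertex of
        \<open>P\<close> by the secondary key, and of the remaining ones at least one ends at each
        vertex of \<open>Q\<close>.\<close>
      have PQ: "card P + card Q + \<gamma> x \<le> K"
      proof -
        let ?f = "\<lambda>u. \<Sum>v\<in>V - Z x. e u v"
        have "card P \<le> (\<Sum>u\<in>P. ?f u)"
        proof (rule card_le_sum_pos[OF fins(1)])
          fix u assume u: "u \<in> P"
          then have "u \<in> V" using Z_sub unfolding P_def by blast
          then have "Z u = Z x" "\<gamma> x \<le> \<gamma> u" using earlier[OF _ x] u unfolding P_def by blast+
          then show "0 < ?f u" using \<gamma>1 unfolding \<gamma>_def by simp
        qed
        moreover have "card Q \<le> (\<Sum>u\<in>Z x - P - {x}. ?f u)"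
        proof -
          have "card Q \<le> (\<Sum>v\<in>Q. \<Sum>u\<in>Z x - P - {x}. e u v)"
          proof (rule card_le_sum_pos[OF fins(2)])
            fix v assume "v \<in> Q"
            then obtain w where "w \<in> Z x - P - {x}" "0 < e w v" unfolding Q_def by blast
            then show "0 < (\<Sum>u\<in>Z x - P - {x}. e u v)" using finZ by (intro sum_pos2[of _ w]) auto
          qed
          also have "\<dots> \<le> (\<Sum>v\<in>V - Z x. \<Sum>u\<in>Z x - P - {x}. e u v)"
            using fin by (intro sum_mono2) (auto simp: Q_def)
          also have "\<dots> = (\<Sum>u\<in>Z x - P - {x}. ?f u)" by (rule sum.swap)
          finally show ?thesis .
        qed
        moreover have "(\<Sum>u\<in>Z x. ?f u) = ?f x + ((\<Sum>u\<in>P. ?f u) + (\<Sum>u\<in>Z x - P - {x}. ?f u))"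
        proof -
          have xP: "x \<notin> P" "P \<subseteq> Z x" unfolding P_def by auto
          have "(\<Sum>u\<in>Z x. ?f u) = ?f x + (\<Sum>u\<in>Z x - {x}. ?f u)"
            using finZ Z_self[OF x] by (rule sum.remove)
          also have "(\<Sum>u\<in>Z x - {x}. ?f u) = (\<Sum>u\<in>Z x - {x} - P. ?f u) + (\<Sum>u\<in>P. ?f u)"
            using finZ xP by (intro sum.subset_diff) auto
          also have "Z x - {x} - P = Z x - P - {x}" by blast
          finally show ?thesis by simp
        qed
        moreover have "(\<Sum>u\<in>Z x. ?f u) = K"
          using Z_tight[OF ZV] unfolding av_def cut_size_def by blast
        ultimately show ?thesis unfolding \<gamma>_def by linarith
      qed
      have inner: "(\<Union>w\<in>W \<inter> Z x. xspan g (S w)) \<subseteq> xspan g (P \<union> Q)"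
      proof (intro UN_least xspan_mono subsetI)
        fix w u assume w: "w \<in> W \<inter> Z x" and u: "u \<in> S w"
        have "rk x < rk w" using w unfolding W_def nb_def by blast
        then have "w \<in> Z x - P - {x}" using w unfolding P_def by auto
        moreover have "u \<in> V" "rk u < rk x" "0 < e w u"
          using u mgraph_sym[OF e, of u w] unfolding S_def nb_def by auto
        ultimately show "u \<in> P \<union> Q" unfolding P_def Q_def by blast
      qed
      have "card (\<Union>w\<in>W \<inter> Z x. xspan g (S w)) \<le> card (xspan g (P \<union> Q))"
        using inner fins by (intro card_mono finite_xspan) auto
      also have "\<dots> \<le> 2 ^ card (P \<union> Q)" using fins by (intro card_xspan_le) auto
      also have "\<dots> \<le> 2 ^ (K - \<gamma> x)"
        using PQ card_Un_le[of P Q] by (intro power_increasing) auto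
      finally have in_bound: "card (\<Union>w\<in>W \<inter> Z x. xspan g (S w)) \<le> 2 ^ (K - \<gamma> x)" .
      \<comment> \<open>Later neighbours outside \<open>Z x\<close> are counted singly; together
        with \<open>nb x\<close> they number at most \<open>\<gamma> x\<close>.\<close>
      have "card (\<Union>w\<in>W - Z x. xspan g (S w)) \<le> (\<Sum>w\<in>W - Z x. card (xspan g (S w)))"
        using W_fin by (intro card_UN_le) auto
      also have "\<dots> \<le> card (W - Z x) * 2 ^ (K - 1)"
        using sum_bounded_above[of "W - Z x" "\<lambda>w. card (xspan g (S w))" "2 ^ (K - 1)"] span_card by auto
      finally have out_bound: "card (\<Union>w\<in>W - Z x. xspan g (S w)) \<le> card (W - Z x) * 2 ^ (K - 1)" .
      have "B = (\<Union>w\<in>W \<inter> Z x. xspan g (S w)) \<union> (\<Union>w\<in>W - Z x. xspan g (S w))"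
        unfolding B_def by blast
      then have "card B \<le> 2 ^ (K - \<gamma> x) + card (W - Z x) * 2 ^ (K - 1)"
        using order_trans[OF card_Un_le add_mono[OF in_bound out_bound]] by simp
      then have "card B * 2 ^ card (nb x) \<le> (2 ^ (K - \<gamma> x) + card (W - Z x) * 2 ^ (K - 1)) * 2 ^ card (nb x)"
        by (rule mult_le_mono1)
      also have "\<dots> < 2 ^ (2 * K - 1)"
      proof (rule span_bound_arith[OF _ \<gamma>_le[OF x] K])
        have "nb x \<inter> (W - Z x) = {}" unfolding W_def nb_def by auto
        then have "card (nb x) + card (W - Z x) = card (nb x \<union> (W - Z x))"
          using nb_fin W_fin by (simp add: card_Un_disjoint)
        also have "\<dots> \<le> \<gamma> x"
        proof (rule nbr_count)
          show "nb x \<union> (W - Z x) \<subseteq> V - Z x" using nb_out[OF x] unfolding W_def by blast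
          show "0 < e x v" if "v \<in> nb x \<union> (W - Z x)" for v
            using that mgraph_sym[OF e, of v x] unfolding W_def nb_def by auto
        qed
        finally show "card (nb x) + card (W - Z x) \<le> \<gamma> x" .
      qed
      also have "\<dots> \<le> 2 ^ t" using t(2) by (intro power_increasing) auto
      finally show ?thesis .
    qed
    then show "card (\<Union>w\<in>{w \<in> V. x \<in> nb w}. xspan g {u \<in> nb w. rk u < rk x}) * 2 ^ card (nb x) < 2 ^ card {..<t}"
      unfolding B_def W_def S_def by simp
  qed
  then obtain g where g: "\<forall>v\<in>V. g v \<subseteq> {..<t}" "\<forall>v\<in>V. \<forall>u\<in>nb v. odd (card (g u \<inter> g v)) \<longleftrightarrow> c u v" by blast
  have "odd (card (g u \<inter> g v)) \<longleftrightarrow> c u v" if pos: "0 < e u v" for u v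
  proof -
    have "u \<noteq> v" using pos mgraph_irrefl[OF e] by (metis less_irrefl)
    then have "rk u \<noteq> rk v" unfolding rk_def by simp
    then consider "rk u < rk v" | "rk v < rk u" by (meson linorder_neqE)
    then show ?thesis
    proof cases
      case 1
      then have "u \<in> nb v" using pos inV[OF pos] unfolding nb_def by simp
      then show ?thesis using g(2) inV[OF pos] by blast
    next
      case 2
      then have "v \<in> nb u" using pos inV[OF pos] mgraph_sym[OF e, of u v] unfolding nb_def by simp
      then have "odd (card (g v \<inter> g u)) \<longleftrightarrow> c v u" using g(2) inV[OF pos] by blast
      then show ?thesis using c by (simp add: Int_commute)
    qed
  qed
  then show ?thesis using g(1) by blast
qed

section \<open>Upper bound\<close>

lemma invert_iff:
  "(u, v) \<in> invert X A \<longleftrightarrow> (u, v) \<in> A \<and> \<not> (u \<in> X \<and> v \<in> X) \<or> (v, u) \<in> A \<and> u \<in> X \<and> v \<in> X"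
  unfolding invert_def by auto

lemma reorient_iff: "(u, v) \<in> reorient c A \<longleftrightarrow> (u, v) \<in> A \<and> \<not> c u v \<or> (v, u) \<in> A \<and> c v u"
  unfolding reorient_def by simp

definition joint_count :: "nat set list \<Rightarrow> nat \<Rightarrow> nat \<Rightarrow> nat" where
  "joint_count Xs u v = length (filter (\<lambda>X. u \<in> X \<and> v \<in> X) Xs)"

text \<open>Whether a set flips a pair does not depend on the current direction of its arcs, so only
  the parity of the number of common sets matters.\<close>

lemma Inv_eq_reorient: "Inv A Xs = reorient (\<lambda>u v. odd (joint_count Xs u v)) A"
proof (induction Xs rule: rev_induct)
  case Nil
  show ?case unfolding Inv_def joint_count_def reorient_def by auto
next
  case (snoc X Xs)
  have sym: "joint_count Xs u v = joint_count Xs v u" for u v unfolding joint_count_def by (simp add: conj_commute)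
  have "(u, v) \<in> Inv A (Xs @ [X]) \<longleftrightarrow> (u, v) \<in> reorient (\<lambda>u v. odd (joint_count (Xs @ [X]) u v)) A" for u v
  proof -
    have inv: "Inv A (Xs @ [X]) = invert X (Inv A Xs)" unfolding Inv_def by simp
    have jc: "joint_count (Xs @ [X]) a b = joint_count Xs a b + of_bool (a \<in> X \<and> b \<in> X)" for a b
      unfolding joint_count_def by simp
    show ?thesis
      unfolding inv snoc invert_iff reorient_iff jc sym[of v u]
      by (cases "u \<in> X \<and> v \<in> X"; cases "odd (joint_count Xs u v)") (simp_all, blast+)
  qed
  then show ?case by auto
qed

lemma k_arc_strong_mono:
  assumes "k_arc_strong k n A" "A \<subseteq> B"
  shows "k_arc_strong k n B"
  unfolding k_arc_strong_def
proof (intro allI impI)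
  fix V1 V2 assume V: "V1 \<inter> V2 = {} \<and> V1 \<union> V2 = {..<n} \<and> V1 \<noteq> {} \<and> V2 \<noteq> {}"
  then have "V1 \<subseteq> {..<n}" "V2 \<subseteq> {..<n}" by blast+
  then have "finite (V1 \<times> V2)" using finite_subset by blast
  then have "finite {(u, v) \<in> B. u \<in> V1 \<and> v \<in> V2}" by (rule rev_finite_subset) auto
  then have "arcs_from_to A V1 V2 \<le> arcs_from_to B V1 V2"
    unfolding arcs_from_to_def using assms(2) by (intro card_mono) auto
  moreover have "k \<le> arcs_from_to A V1 V2" using assms(1) V unfolding k_arc_strong_def by blast
  ultimately show "k \<le> arcs_from_to B V1 V2" by linarith
qed

text \<open>The \<open>j\<close>-th set consists of the vertices whose vector contains
  \<open>j\<close>. Arcs of \<open>A\<close> outside \<open>H\<close> may end up in any direction,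
  as extra arcs do no harm.\<close>

lemma sinv_digraph_le_of_vectors:
  assumes D: "digraph_on n A" and HA: "H \<subseteq> A"
    and strong: "k_arc_strong k n (reorient c H)"
    and g: "\<And>v. v < n \<Longrightarrow> g v \<subseteq> {..<t}"
    and real: "\<And>u v. (u, v) \<in> H \<Longrightarrow> odd (card (g u \<inter> g v)) \<longleftrightarrow> c u v"
  shows "sinv_digraph k n A \<le> enat t"
proof -
  define Xs where "Xs = map (\<lambda>j. {v. v < n \<and> j \<in> g v}) [0..<t]"
  have count: "joint_count Xs u v = card (g u \<inter> g v)" if "u < n" "v < n" for u v
  proof -
    have "joint_count Xs u v = length (filter (\<lambda>j. j \<in> g u \<and> j \<in> g v) [0..<t])"
      unfolding joint_count_def Xs_def filter_map using that by (simp add: comp_def)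
    also have "\<dots> = card (set (filter (\<lambda>j. j \<in> g u \<and> j \<in> g v) [0..<t]))"
      by (intro distinct_card[symmetric] distinct_filter distinct_upt)
    also have "set (filter (\<lambda>j. j \<in> g u \<and> j \<in> g v) [0..<t]) = g u \<inter> g v"
      using g[OF that(1)] by auto
    finally show ?thesis .
  qed
  have "reorient c H \<subseteq> Inv A Xs"
  proof (rule subrelI)
    fix u v assume uv: "(u, v) \<in> reorient c H"
    have lt: "x < n \<and> y < n" if "(x, y) \<in> H" for x y
      using that HA D unfolding digraph_on_def by blast
    from uv show "(u, v) \<in> Inv A Xs"
      unfolding reorient_iff Inv_eq_reorient
      using HA real lt count by (metis (full_types) subsetD)
  qed
  then have "k_arc_strong k n (Inv A Xs)" by (rule k_arc_strong_mono[OF strong])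
  moreover have "\<forall>X\<in>set Xs. X \<subseteq> {..<n}" unfolding Xs_def by auto
  moreover have "length Xs = t" unfolding Xs_def by simp
  ultimately have "enat t \<in> {enat (length Xs) | Xs. (\<forall>X \<in> set Xs. X \<subseteq> {..<n}) \<and> k_arc_strong k n (Inv A Xs)}"
    by blast
  then show ?thesis unfolding sinv_digraph_def by (rule Inf_lower)
qed

text \<open>In an inclusion-minimal arc set, deleting any arc, even one of a digon, removes one copy
  of a critical edge.\<close>

lemma ex_minimal_edge_connected:
  assumes D: "digraph_on n A" and conn: "edge_connected m n A"
  obtains H where "H \<subseteq> A" "digraph_on n H" "edge_connected m n H"
    "\<And>x y. 0 < arc_mult H x y \<Longrightarrow>
      \<exists>X. X \<subset> {..<n} \<and> X \<noteq> {} \<and> cut_size {..<n} (arc_mult H) X = m \<and> x \<in> X \<and> y \<notin> X"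
proof -
  have "A \<subseteq> {..<n} \<times> {..<n}" using D unfolding digraph_on_def by blast
  then have "finite A" using finite_subset by blast
  then have "finite {B. B \<subseteq> A \<and> edge_connected m n B}" by simp
  moreover have "{B. B \<subseteq> A \<and> edge_connected m n B} \<noteq> {}" using conn by blast
  ultimately obtain H where H: "H \<subseteq> A" "edge_connected m n H"
    and min: "\<And>B. B \<subseteq> A \<Longrightarrow> edge_connected m n B \<Longrightarrow> B \<subseteq> H \<Longrightarrow> H = B"
    using finite_has_minimal[of "{B. B \<subseteq> A \<and> edge_connected m n B}"] by auto
  have DH: "digraph_on n H" using D H unfolding digraph_on_def by blast
  have mH: "mgraph {..<n} (arc_mult H)" using mgraph_arc_mult[OF DH] .
  have cut: "\<exists>X. X \<subset> {..<n} \<and> X \<noteq> {} \<and> cut_size {..<n} (arc_mult H) X = m \<and> (x \<in> X \<and> y \<notin> X)"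
    if xy: "(x, y) \<in> H \<or> (y, x) \<in> H" for x y
  proof -
    define p where "p = (if (x, y) \<in> H then (x, y) else (y, x))"
    have p: "p \<in> H" "p = (x, y) \<or> p = (y, x)" using xy unfolding p_def by auto
    define B where "B = H - {p}"
    have "B \<subseteq> A" "B \<subseteq> H" "B \<noteq> H" using p H unfolding B_def by auto
    then have "\<not> edge_connected m n B" using min by blast
    then have nB: "\<not> econn m {..<n} (arc_mult B)" unfolding edge_connected_iff_econn .
    have V: "x \<in> {..<n}" "y \<in> {..<n}" "x \<noteq> y" using xy DH unfolding digraph_on_def by auto
    have "arc_mult H = (\<lambda>u v. arc_mult B u v + single_edge x y u v)"
      using p V(3) unfolding arc_mult_def B_def single_edge_def by (intro ext) auto
    from critical_edge_in_tight_cut[OF mH this V _ nB] show ?thesis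
      using H(2) unfolding edge_connected_iff_econn by blast
  qed
  show thesis
  proof (rule that[OF H(1) DH H(2)])
    fix x y assume "0 < arc_mult H x y"
    then have "(x, y) \<in> H \<or> (y, x) \<in> H" unfolding arc_mult_def by (auto split: if_splits simp: of_bool_def)
    from cut[OF this] show "\<exists>X. X \<subset> {..<n} \<and> X \<noteq> {} \<and> cut_size {..<n} (arc_mult H) X = m \<and> x \<in> X \<and> y \<notin> X" .
  qed
qed

text \<open>Here \<open>s\<close> is the integer part of the logarithm of \<open>n\<close>. With
  \<open>K = 2 * k\<close>, the condition \<open>2 * K - 1 \<le> t\<close> for
  \<open>t = s + 4 * k - 3\<close> amounts to \<open>2 \<le> s\<close>.\<close>

lemma sinv_digraph_upper:
  assumes D: "digraph_on n A" and conn: "edge_connected (2 * k) n A" and k: "1 \<le> k"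
    and s: "2 \<le> s" "2 ^ s \<le> n" "n < 2 ^ (s + 1)"
  shows "sinv_digraph k n A \<le> enat (s + 4 * k - 3)"
proof -
  obtain H where H: "H \<subseteq> A" "digraph_on n H" "edge_connected (2 * k) n H"
    and crit: "\<And>x y. 0 < arc_mult H x y \<Longrightarrow>
      \<exists>X. X \<subset> {..<n} \<and> X \<noteq> {} \<and> cut_size {..<n} (arc_mult H) X = 2 * k \<and> x \<in> X \<and> y \<notin> X"
    using ex_minimal_edge_connected[OF D conn] by blast
  obtain c where c: "\<And>u v. c u v = c v u" "k_arc_strong k n (reorient c H)"
    using ex_k_arc_strong_reorientation[OF H(2,3) k] by blast
  \<comment> \<open>For \<open>k = 1\<close> the factor is 1 and the claim is exactly
    \<open>n < 2 ^ (s + 1)\<close>; for larger \<open>k\<close> the subtracted 1 can be given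
    away.\<close>
  have "n * (2 ^ (2 * k - 1) - 1) < 2 ^ (s + 4 * k - 3)"
  proof (cases "k = 1")
    case True
    then show ?thesis using s by simp
  next
    case False
    have "n * (2 ^ (2 * k - 1) - 1) \<le> n * 2 ^ (2 * k - 1)" by simp
    also have "\<dots> < 2 ^ (s + 1) * 2 ^ (2 * k - 1)" using s by simp
    also have "\<dots> = 2 ^ (s + 1 + (2 * k - 1))" by (rule power_add[symmetric])
    also have "\<dots> \<le> 2 ^ (s + 4 * k - 3)" using k False by (intro power_increasing) auto
    finally show ?thesis .
  qed
  then have "\<exists>g. (\<forall>v\<in>{..<n}. g v \<subseteq> {..<s + 4 * k - 3})
      \<and> (\<forall>u v. 0 < arc_mult H u v \<longrightarrow> (odd (card (g u \<inter> g v)) \<longleftrightarrow> c u v))"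
    using H(3) k s c(1) crit mgraph_arc_mult[OF H(2)] unfolding edge_connected_iff_econn
    by (intro ex_realising_vectors[where K = "2 * k"]) (auto simp: lessThan_empty_iff)
  then obtain g where g: "\<And>v. v < n \<Longrightarrow> g v \<subseteq> {..<s + 4 * k - 3}"
      "\<And>u v. 0 < arc_mult H u v \<Longrightarrow> (odd (card (g u \<inter> g v)) \<longleftrightarrow> c u v)" by blast
  show ?thesis
  proof (rule sinv_digraph_le_of_vectors[OF D H(1) c(2) g(1)])
    show "odd (card (g u \<inter> g v)) \<longleftrightarrow> c u v" if "(u, v) \<in> H" for u v
      using that by (intro g(2)) (simp add: arc_mult_def)
  qed
qed

text \<open>The case \<open>s = 1\<close>: on three vertices any symmetric \<open>c\<close> is
  realised in dimension 2.\<close>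

lemma sinv_digraph_upper_three:
  assumes D: "digraph_on 3 A" and conn: "edge_connected 2 3 A"
  shows "sinv_digraph 1 3 A \<le> enat 2"
proof -
  obtain c where c: "\<And>u v. c u v = c v u" "k_arc_strong 1 3 (reorient c A)"
    using ex_k_arc_strong_reorientation[OF D, of 1] conn by auto
  \<comment> \<open>Coordinate 0 settles the products with vertex 0; coordinate 1, always present at
    vertex 1, corrects the product of 1 and 2.\<close>
  define g :: "nat \<Rightarrow> nat set" where "g v = (if v = 0 then {0}
      else if v = 1 then insert 1 (if c 0 1 then {0} else {})
      else (if c 0 2 then {0} else {}) \<union> (if c 1 2 \<noteq> (c 0 1 \<and> c 0 2) then {1} else {}))" for v
  have g0: "g 0 = {0}" "g 1 = insert 1 (if c 0 1 then {0} else {})"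
    "g 2 = (if c 0 2 then {0} else {}) \<union> (if c 1 2 \<noteq> (c 0 1 \<and> c 0 2) then {1} else {})"
    unfolding g_def by simp_all
  have pairs: "odd (card (g 0 \<inter> g 1)) \<longleftrightarrow> c 0 1" "odd (card (g 0 \<inter> g 2)) \<longleftrightarrow> c 0 2" "odd (card (g 1 \<inter> g 2)) \<longleftrightarrow> c 1 2"
    unfolding g0 by (cases "c 0 1"; cases "c 0 2"; cases "c 1 2"; simp)+
  show ?thesis
  proof (rule sinv_digraph_le_of_vectors[OF D order_refl c(2)])
    show "g v \<subseteq> {..<2}" for v unfolding g_def by auto
    fix u v assume "(u, v) \<in> A"
    then have "u < 3" "v < 3" "u \<noteq> v" using D unfolding digraph_on_def by auto
    then have "(u = 0 \<or> u = 1 \<or> u = 2) \<and> (v = 0 \<or> v = 1 \<or> v = 2)" by linarith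
    then show "odd (card (g u \<inter> g v)) \<longleftrightarrow> c u v"
      using pairs c(1)[of 0 1] c(1)[of 0 2] c(1)[of 1 2] \<open>u \<noteq> v\<close>
      by (elim conjE disjE) (simp_all add: Int_commute)
  qed
qed

section \<open>Lower bound\<close>

text \<open>Each further vertex lies on one side of the cut, and its edges to the end on the other
  side cross; these edges are distinct for distinct vertices.\<close>

lemma cut_common_neighbours:
  assumes e: "mgraph V e" and X: "X \<subseteq> V" "x0 \<in> X" "y0 \<in> V" "y0 \<notin> X"
  shows "e x0 y0 + (\<Sum>z\<in>V - {x0, y0}. if z \<in> X then e z y0 else e z x0) \<le> cut_size V e X"
proof -
  have fin: "finite V" "finite X" using mgraph_finite[OF e] X finite_subset by auto
  have "V - {x0, y0} = (X - {x0}) \<union> (V - X - {y0})" using X by auto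
  then have "(\<Sum>z\<in>V - {x0, y0}. if z \<in> X then e z y0 else e z x0)
     = (\<Sum>z\<in>X - {x0}. if z \<in> X then e z y0 else e z x0) + (\<Sum>z\<in>V - X - {y0}. if z \<in> X then e z y0 else e z x0)"
    using fin by (simp only:) (rule sum.union_disjoint, auto)
  also have "(\<Sum>z\<in>X - {x0}. if z \<in> X then e z y0 else e z x0) = (\<Sum>z\<in>X - {x0}. e z y0)"
    by (intro sum.cong) auto
  also have "(\<Sum>z\<in>V - X - {y0}. if z \<in> X then e z y0 else e z x0) = (\<Sum>z\<in>V - X - {y0}. e x0 z)"
    using mgraph_sym[OF e, of _ x0] by (intro sum.cong) auto
  finally have "e x0 y0 + (\<Sum>z\<in>V - {x0, y0}. if z \<in> X then e z y0 else e z x0)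
      = (\<Sum>z\<in>X - {x0}. e z y0) + (e x0 y0 + (\<Sum>z\<in>V - X - {y0}. e x0 z))" by simp
  also have "e x0 y0 + (\<Sum>z\<in>V - X - {y0}. e x0 z) = (\<Sum>z\<in>V - X. e x0 z)"
    using fin X by (intro sum.remove[symmetric]) auto
  also have "(\<Sum>z\<in>X - {x0}. e z y0) \<le> (\<Sum>z\<in>X - {x0}. \<Sum>v\<in>V - X. e z v)"
    using fin X by (intro sum_mono member_le_sum) auto
  also have "(\<Sum>z\<in>X - {x0}. \<Sum>v\<in>V - X. e z v) + (\<Sum>z\<in>V - X. e x0 z) = cut_size V e X"
    unfolding cut_size_def using sum.remove[OF fin(2) X(2), of "\<lambda>z. \<Sum>v\<in>V - X. e z v"] by simp
  finally show ?thesis by simp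
qed

lemma econn_if_cuts_around:
  assumes e: "mgraph V e" and r: "r \<in> V" and cuts: "\<And>X. X \<subset> V \<Longrightarrow> r \<in> X \<Longrightarrow> K \<le> cut_size V e X"
  shows "econn K V e"
  unfolding econn_def
proof (intro allI impI)
  fix X assume X: "X \<subset> V \<and> X \<noteq> {}"
  show "K \<le> cut_size V e X"
  proof (cases "r \<in> X")
    case True then show ?thesis using cuts X by blast
  next
    case False
    then have "V - X \<subset> V" "r \<in> V - X" using X r by blast+
    then have "K \<le> cut_size V e (V - X)" by (rule cuts)
    then show ?thesis using cut_compl[OF e, of X V] X by (simp add: psubset_imp_subset)
  qed
qed

text \<open>The infimum is attained: without a family of length at most \<open>t\<close>, the number
  \<open>Suc t\<close> would be a lower bound.\<close>

lemma sinv_digraph_leE: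
  assumes "sinv_digraph k n A \<le> enat t"
  obtains Xs where "length Xs \<le> t" "k_arc_strong k n (Inv A Xs)"
proof -
  let ?S = "{enat (length Xs) | Xs. (\<forall>X \<in> set Xs. X \<subseteq> {..<n}) \<and> k_arc_strong k n (Inv A Xs)}"
  have "\<exists>x\<in>?S. x \<le> enat t"
  proof (rule ccontr)
    assume no: "\<not> (\<exists>x\<in>?S. x \<le> enat t)"
    have "enat (Suc t) \<le> x" if x: "x \<in> ?S" for x
    proof -
      obtain l where "x = enat l" using x by blast
      moreover have "\<not> x \<le> enat t" using no x by blast
      ultimately show ?thesis by simp
    qed
    then have "enat (Suc t) \<le> Inf ?S" by (intro Inf_greatest)
    then have "enat (Suc t) \<le> enat t" using assms unfolding sinv_digraph_def by (rule order_trans)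
    then show False by simp
  qed
  then show thesis using that by auto
qed

lemma k_arc_strong_out_nbrs:
  assumes "k_arc_strong k n R" "w < n" "2 \<le> n" "finite S" "\<And>v. (w, v) \<in> R \<Longrightarrow> v \<in> S"
  shows "k \<le> card S"
proof -
  have "{w} \<inter> ({..<n} - {w}) = {} \<and> {w} \<union> ({..<n} - {w}) = {..<n} \<and> {w} \<noteq> {} \<and> {..<n} - {w} \<noteq> {}"
  proof -
    have "(if w = 0 then 1 else 0) \<in> {..<n} - {w}" using assms by auto
    then show ?thesis using assms by blast
  qed
  then have "k \<le> arcs_from_to R {w} ({..<n} - {w})" using assms(1) unfolding k_arc_strong_def by blast
  also have "\<dots> \<le> card (Pair w ` S)"
    unfolding arcs_from_to_def using assms(4,5) by (intro card_mono) auto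
  also have "\<dots> \<le> card S" using assms(4) by (rule card_image_le)
  finally show ?thesis .
qed

lemma k_arc_strong_in_nbrs:
  assumes "k_arc_strong k n R" "w < n" "2 \<le> n" "finite S" "\<And>v. (v, w) \<in> R \<Longrightarrow> v \<in> S"
  shows "k \<le> card S"
proof -
  have "({..<n} - {w}) \<inter> {w} = {} \<and> ({..<n} - {w}) \<union> {w} = {..<n} \<and> {..<n} - {w} \<noteq> {} \<and> {w} \<noteq> {}"
  proof -
    have "(if w = 0 then 1 else 0) \<in> {..<n} - {w}" using assms by auto
    then show ?thesis using assms by blast
  qed
  then have "k \<le> arcs_from_to R ({..<n} - {w}) {w}" using assms(1) unfolding k_arc_strong_def by blast
  also have "\<dots> \<le> card ((\<lambda>v. (v, w)) ` S)"
    unfolding arcs_from_to_def using assms(4,5) by (intro card_mono) auto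
  also have "\<dots> \<le> card S" using assms(4) by (rule card_image_le)
  finally show ?thesis .
qed

text \<open>If both arcs from \<open>i\<close> and \<open>j\<close> are reversed, all in-neighbours
  of \<open>w\<close> lie in \<open>U\<close>; if both are kept, all out-neighbours do. But
  \<open>U\<close> has fewer than \<open>k\<close> elements.\<close>

lemma sink_with_two_sources_splits:
  assumes R: "k_arc_strong k n (reorient c A)" and w: "w < n" "2 \<le> n"
    and U: "finite U" "card U < k"
    and out: "\<And>v. (w, v) \<in> A \<Longrightarrow> v \<in> U" and into: "\<And>v. (v, w) \<in> A \<Longrightarrow> v \<in> U \<or> v = i \<or> v = j"
  shows "c i w \<noteq> c j w"
proof
  assume eq: "c i w = c j w"
  show False
  proof (cases "c i w")
    case True
    have "v \<in> U" if "(v, w) \<in> reorient c A" for v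
      using that out[of v] into[of v] True eq unfolding reorient_iff by auto
    then show False using k_arc_strong_in_nbrs[OF R w U(1)] U(2) by (meson not_less)
  next
    case False
    have "v \<in> U" if "(w, v) \<in> reorient c A" for v
      using that out[of v] into[of v] False eq unfolding reorient_iff by auto
    then show False using k_arc_strong_out_nbrs[OF R w U(1)] U(2) by (meson not_less)
  qed
qed

lemma joint_count_card: "joint_count Xs u v = card {l. l < length Xs \<and> u \<in> Xs ! l \<and> v \<in> Xs ! l}"
  unfolding joint_count_def length_filter_conv_card ..

lemma ex_surj_onto:
  assumes "finite W" "finite P" "card P \<le> card W" "P \<noteq> {}"
  shows "\<exists>p. (\<forall>w\<in>W. p w \<in> P) \<and> (\<forall>q\<in>P. \<exists>w\<in>W. p w = q)"
proof -
  obtain f where f: "f ` P \<subseteq> W" "inj_on f P" using card_le_inj[OF assms(2,1,3)] by blast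
  obtain q0 where q0: "q0 \<in> P" using assms(4) by blast
  define p where "p w = (if w \<in> f ` P then inv_into P f w else q0)" for w
  have "p w \<in> P" for w unfolding p_def using q0 by (simp add: inv_into_into)
  moreover have "\<exists>w\<in>W. p w = q" if "q \<in> P" for q
    using f that unfolding p_def by (intro bexI[of _ "f q"]) (auto simp: inv_into_f_f)
  ultimately show ?thesis by blast
qed

section \<open>Digraphs needing many inversions\<close>

text \<open>Vertices below \<open>m\<close> are hubs, \<open>U\<close> holds the
  \<open>k - 1\<close> vertices joined to everything, and the remaining vertices are the sinks.
  Surplus sinks repeat a hub pair.\<close>

lemma ex_digraph_with_hubs:
  fixes k m n :: nat
  assumes k: "1 \<le> k" and m: "2 \<le> m" and n: "m + (\<Sum>j<m. j) + (k - 1) \<le> n"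
  shows "\<exists>A. digraph_on n A \<and> edge_connected (2 * k) n A \<and> (\<forall>t. sinv_digraph k n A \<le> enat t \<longrightarrow> m \<le> 2 ^ t)"
proof -
  define b where "b = m + (k - 1)"
  define U where "U = {m..<b}"
  have U: "finite U" "card U = k - 1" unfolding U_def b_def by simp_all
  have bn: "b + (\<Sum>j<m. j) \<le> n" using n unfolding b_def by simp
  define P where "P = (SIGMA j:{..<m}. {..<j})"
  have finP: "finite P" unfolding P_def by simp
  have "card P = (\<Sum>j<m. j)" unfolding P_def by simp
  then have "card P \<le> card {b..<n}" using bn by simp
  moreover have "(1, 0) \<in> P" unfolding P_def using m by simp
  ultimately obtain p where p: "\<And>w. w \<in> {b..<n} \<Longrightarrow> p w \<in> P" "\<And>q. q \<in> P \<Longrightarrow> \<exists>w\<in>{b..<n}. p w = q"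
    using ex_surj_onto[OF finite_atLeastLessThan finP, of b n] by blast
  have hubs: "fst (p w) < m" "snd (p w) < m" "fst (p w) \<noteq> snd (p w)" if "b \<le> w" "w < n" for w
    using p(1)[of w] that unfolding P_def by (auto simp: Sigma_def)
  \<comment> \<open>Hubs and \<open>U\<close> are pairwise joined by digons; sinks are joined by
    digons to \<open>U\<close> and otherwise only receive arcs from the two hubs of
    \<open>p y\<close>.\<close>
  define A where "A = {(x, y). x \<noteq> y \<and> x < n \<and> y < n \<and>
    (x < b \<and> y < b \<or> x \<in> U \<or> y \<in> U \<or> b \<le> y \<and> (x = fst (p y) \<or> x = snd (p y)))}"
  have A_iff: "(x, y) \<in> A \<longleftrightarrow> x \<noteq> y \<and> x < n \<and> y < n \<and>
    (x < b \<and> y < b \<or> x \<in> U \<or> y \<in> U \<or> b \<le> y \<and> (x = fst (p y) \<or> x = snd (p y)))" for x y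
    unfolding A_def by simp
  have D: "digraph_on n A" unfolding digraph_on_def A_def by auto
  have mb: "m \<le> b" "b \<le> n" using bn unfolding b_def by simp_all
  let ?V = "{..<n}"
  let ?e = "arc_mult A"
  have e: "mgraph ?V ?e" using mgraph_arc_mult[OF D] .
  have two: "?e x y = 2" if "x \<noteq> y" "x < n" "y < n" "x < b \<and> y < b \<or> x \<in> U" for x y
    using that unfolding arc_mult_def A_iff by auto
  have one: "1 \<le> ?e x y" if "x < n" "y < n" "b \<le> y" "x = fst (p y) \<or> x = snd (p y)" for x y
    using that hubs[of y] mb unfolding arc_mult_def A_iff by auto
  have "econn (2 * k) ?V ?e"
  proof (rule econn_if_cuts_around[OF e])
    show "0 \<in> ?V" using m mb by simp
    fix X assume X: "X \<subset> ?V" "0 \<in> X"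
    show "2 * k \<le> cut_size ?V ?e X"
    proof (cases "{..<b} \<subseteq> X")
      case False
      then obtain y where y: "y < b" "y \<notin> X" by auto
      have y0: "y \<noteq> 0" using y X by metis
      \<comment> \<open>\<open>0\<close> and \<open>y\<close> are joined by a digon and have
        \<open>b - 2\<close> common neighbours of multiplicity 2 below \<open>b\<close>;
        \<open>m \<ge> 2\<close> gives \<open>b \<ge> k + 1\<close>.\<close>
      have "2 * k \<le> 2 + (\<Sum>z\<in>{..<b} - {0, y}. 2)"
      proof -
        have "card ({..<b} - {0, y}) = b - 2" using y y0 by (subst card_Diff_subset) auto
        then show ?thesis using m k unfolding b_def by simp
      qed
      also have "(\<Sum>z\<in>{..<b} - {0, y}. 2) = (\<Sum>z\<in>{..<b} - {0, y}. if z \<in> X then ?e z y else ?e z 0)"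
      proof (rule sum.cong[OF refl])
        fix z assume "z \<in> {..<b} - {0, y}"
        then show "2 = (if z \<in> X then ?e z y else ?e z 0)" using two[of z y] two[of z 0] y mb by auto
      qed
      also have "\<dots> \<le> (\<Sum>z\<in>?V - {0, y}. if z \<in> X then ?e z y else ?e z 0)"
        using mb by (intro sum_mono2) auto
      also have "2 + (\<Sum>z\<in>?V - {0, y}. if z \<in> X then ?e z y else ?e z 0) =
          ?e 0 y + (\<Sum>z\<in>?V - {0, y}. if z \<in> X then ?e z y else ?e z 0)"
        using two[of 0 y] y y0 mb by simp
      also have "\<dots> \<le> cut_size ?V ?e X"
        using cut_common_neighbours[OF e _ X(2), of y] X(1) y mb by auto
      finally show ?thesis by simp
    next
      case True
      then obtain w where w: "w < n" "w \<notin> X" using X(1) by auto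
      have wb: "b \<le> w" using True w by (meson lessThan_iff not_le subsetD)
      define i where "i = fst (p w)"
      define j where "j = snd (p w)"
      have ij: "i < m" "j < m" "i \<noteq> j" using hubs[OF wb w(1)] unfolding i_def j_def by simp_all
      have iX: "i \<in> X" "j \<in> X" "U \<subseteq> X" using True ij mb unfolding U_def by auto
      have jU: "j \<notin> U" using ij unfolding U_def by simp
      \<comment> \<open>All edges at the sink \<open>w\<close> cross the cut: one to each of its
        hubs and two to each vertex of \<open>U\<close>.\<close>
      have "2 * k = 1 + (1 + (\<Sum>u\<in>U. 2))" using U k by simp
      also have "(\<Sum>u\<in>U. 2) = (\<Sum>u\<in>U. ?e u w)"
        using two[of _ w] w wb mb by (intro sum.cong refl) (auto simp: U_def)
      also have "1 + (\<Sum>u\<in>U. ?e u w) \<le> ?e j w + (\<Sum>u\<in>U. ?e u w)"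
        using one[of j w] w wb ij mb unfolding j_def by auto
      also have "\<dots> = (\<Sum>z\<in>insert j U. ?e z w)" using U jU by simp
      also have "\<dots> = (\<Sum>z\<in>insert j U. if z \<in> X then ?e z w else ?e z i)" using iX by (intro sum.cong) auto
      also have "\<dots> \<le> (\<Sum>z\<in>?V - {i, w}. if z \<in> X then ?e z w else ?e z i)"
        using ij mb w wb by (intro sum_mono2) (auto simp: U_def)
      also have "1 + (\<Sum>z\<in>?V - {i, w}. if z \<in> X then ?e z w else ?e z i) \<le>
          ?e i w + (\<Sum>z\<in>?V - {i, w}. if z \<in> X then ?e z w else ?e z i)"
        using one[of i w] w wb ij mb unfolding i_def by auto
      also have "\<dots> \<le> cut_size ?V ?e X"
        using cut_common_neighbours[OF e _ iX(1), of w] X(1) w by auto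
      finally show ?thesis by simp
    qed
  qed
  then have "edge_connected (2 * k) n A" unfolding edge_connected_iff_econn .
  moreover have "m \<le> 2 ^ t" if t: "sinv_digraph k n A \<le> enat t" for t
  proof -
    obtain Xs where Xs: "length Xs \<le> t" "k_arc_strong k n (Inv A Xs)" using sinv_digraph_leE[OF t] .
    \<comment> \<open>The vector of hub \<open>i\<close>. Hubs with equal vectors would have their
      arcs flipped alike at their common sink, whichever sets contain it.\<close>
    define sig where "sig i = {l. l < length Xs \<and> i \<in> Xs ! l}" for i
    have "sig i \<noteq> sig j" if ij: "j < i" "i < m" for i j
    proof
      assume eq: "sig i = sig j"
      have "(i, j) \<in> P" using ij unfolding P_def by simp
      then obtain w where w: "b \<le> w" "w < n" "p w = (i, j)" using p(2) by fastforce
      have "odd (joint_count Xs i w) \<noteq> odd (joint_count Xs j w)"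
      proof (rule sink_with_two_sources_splits[where U = U and c = "\<lambda>u v. odd (joint_count Xs u v)"])
        show "k_arc_strong k n (reorient (\<lambda>u v. odd (joint_count Xs u v)) A)"
          using Xs(2) unfolding Inv_eq_reorient .
        show "w < n" "2 \<le> n" "finite U" "card U < k" using w m mb U k by auto
        show "v \<in> U" if "(w, v) \<in> A" for v
          using that w hubs[of v] mb unfolding A_iff U_def by auto
        show "v \<in> U \<or> v = i \<or> v = j" if "(v, w) \<in> A" for v
          using that w mb unfolding A_iff U_def by auto
      qed
      moreover have "{l. l < length Xs \<and> i \<in> Xs ! l \<and> w \<in> Xs ! l} = {l. l < length Xs \<and> j \<in> Xs ! l \<and> w \<in> Xs ! l}"
        using eq unfolding sig_def by blast
      ultimately show False unfolding joint_count_card by simp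
    qed
    then have "inj_on sig {..<m}" unfolding inj_on_def by (metis lessThan_iff linorder_neqE_nat)
    moreover have "sig ` {..<m} \<subseteq> Pow {..<length Xs}" unfolding sig_def by auto
    ultimately have "card {..<m} \<le> card (Pow {..<length Xs})" by (intro card_inj_on_le) auto
    then have "m \<le> 2 ^ length Xs" by (simp add: card_Pow)
    also have "\<dots> \<le> 2 ^ t" using Xs(1) by (intro power_increasing) auto
    finally show ?thesis .
  qed
  ultimately show ?thesis using D by blast
qed

text \<open>For \<open>n - k + 1 = 5\<close> the hubs fall short: no \<open>m\<close> satisfies \<open>m * (m + 1) div 2 \<le> 5 \<le> m ^ 2\<close>.\<close>

lemma ex_digraph_five:
  fixes k n :: nat
  assumes k: "1 \<le> k" and n: "n = k + 4"
  shows "\<exists>A. digraph_on n A \<and> edge_connected (2 * k) n A \<and> (\<forall>t. sinv_digraph k n A \<le> enat t \<longrightarrow> 2 \<le> t)"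
proof -
  define U where "U = {5..<n}"
  have U: "finite U" "card U = k - 1" unfolding U_def n by simp_all
  \<comment> \<open>All arcs from \<open>{0, 1}\<close> to \<open>{2, 3, 4}\<close>, together with
    the \<open>k - 1\<close> vertices of \<open>U\<close> joined to everything by digons.\<close>
  define A where "A = {(x, y). x \<noteq> y \<and> x < n \<and> y < n \<and> (5 \<le> x \<or> 5 \<le> y \<or> x < 2 \<and> 2 \<le> y)}"
  have A_iff: "(x, y) \<in> A \<longleftrightarrow> x \<noteq> y \<and> x < n \<and> y < n \<and> (5 \<le> x \<or> 5 \<le> y \<or> x < 2 \<and> 2 \<le> y)" for x y
    unfolding A_def by simp
  have D: "digraph_on n A" unfolding digraph_on_def A_def by auto
  let ?V = "{..<n}"
  let ?e = "arc_mult A"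
  have e: "mgraph ?V ?e" using mgraph_arc_mult[OF D] .
  have two: "?e x y = 2" if "x \<noteq> y" "x < n" "y < n" "5 \<le> x \<or> 5 \<le> y" for x y
    using that unfolding arc_mult_def A_iff by auto
  have one: "?e x y = 1" if "x < 2 \<and> 2 \<le> y \<and> y < 5 \<or> y < 2 \<and> 2 \<le> x \<and> x < 5" for x y
    using that k unfolding arc_mult_def A_iff n by auto
  have "econn (2 * k) ?V ?e"
  proof (rule econn_if_cuts_around[OF e])
    show "0 \<in> ?V" using n by simp
    fix X assume X: "X \<subset> ?V" "0 \<in> X"
    have XV: "X \<subseteq> ?V" using X by blast
    show "2 * k \<le> cut_size ?V ?e X"
    proof (cases "1 \<in> X")
      case False
      \<comment> \<open>\<open>0\<close> and \<open>1\<close> are not adjacent; their common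
        neighbours 2, 3, 4 give 3 edges and those in \<open>U\<close> give
        \<open>2 * (k - 1)\<close>.\<close>
      have "2 * k \<le> (\<Sum>z\<in>{2,3,4::nat}. 1) + (\<Sum>z\<in>U. 2)" using U k by simp
      also have "\<dots> = (\<Sum>z\<in>{2,3,4}. if z \<in> X then ?e z 1 else ?e z 0) + (\<Sum>z\<in>U. if z \<in> X then ?e z 1 else ?e z 0)"
        using one two n by (intro arg_cong2[where f = "(+)"] sum.cong) (auto simp: U_def)
      also have "\<dots> = (\<Sum>z\<in>{2,3,4} \<union> U. if z \<in> X then ?e z 1 else ?e z 0)"
        using U by (intro sum.union_disjoint[symmetric]) (auto simp: U_def)
      also have "\<dots> \<le> (\<Sum>z\<in>?V - {0, 1}. if z \<in> X then ?e z 1 else ?e z 0)"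
        using n k by (intro sum_mono2) (auto simp: U_def)
      also have "\<dots> \<le> cut_size ?V ?e X"
        using cut_common_neighbours[OF e XV X(2), of 1] n False by simp
      finally show ?thesis .
    next
      case True
      show ?thesis
      proof (cases "\<exists>w\<in>{2,3,4}. w \<notin> X")
        case False
        then have in_X: "z \<in> X" if "z < 5" for z
          using that X(2) True by (auto simp: less_Suc_eq numeral_eq_Suc)
        obtain y where y: "y < n" "y \<notin> X" using X(1) by auto
        have y5: "5 \<le> y" using in_X y by (meson not_le)
        have "2 * k \<le> 2 + (\<Sum>z\<in>?V - {0, y}. 2)"
        proof -
          have "card (?V - {0, y}) = n - 2" using y y5 by (subst card_Diff_subset) auto
          then show ?thesis using n by simp
        qed
        also have "\<dots> = ?e 0 y + (\<Sum>z\<in>?V - {0, y}. if z \<in> X then ?e z y else ?e z 0)"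
        proof -
          have "(if z \<in> X then ?e z y else ?e z 0) = 2" if "z \<in> ?V - {0, y}" for z
            using that two[of z y] two[of z 0] y y5 in_X[of z] by (cases "5 \<le> z") auto
          moreover have "?e 0 y = 2" using two[of 0 y] y y5 by simp
          ultimately show ?thesis by simp
        qed
        also have "\<dots> \<le> cut_size ?V ?e X"
          using cut_common_neighbours[OF e XV X(2), of y] y by simp
        finally show ?thesis .
      next
        case w': True
        then obtain w where w: "w \<in> {2,3,4}" "w \<notin> X" by blast
        have wn: "w < n" "2 \<le> w" "w < 5" using w(1) n k by auto
        have "2 * k = 1 + (1 + (\<Sum>z\<in>U. 2))" using U k by simp
        also have "1 + (\<Sum>z\<in>U. 2) = (\<Sum>z\<in>insert 1 U. if z \<in> X then ?e z w else ?e z 0)"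
        proof -
          have "(\<Sum>z\<in>U. 2) = (\<Sum>z\<in>U. if z \<in> X then ?e z w else ?e z 0)"
            using two wn by (intro sum.cong) (auto simp: U_def)
          moreover have "?e 1 w = 1" using one wn by simp
          ultimately show ?thesis using U(1) True by (simp add: U_def)
        qed
        also have "\<dots> \<le> (\<Sum>z\<in>?V - {0, w}. if z \<in> X then ?e z w else ?e z 0)"
          using wn by (intro sum_mono2) (auto simp: U_def)
        also have "1 + (\<Sum>z\<in>?V - {0, w}. if z \<in> X then ?e z w else ?e z 0) =
           ?e 0 w + (\<Sum>z\<in>?V - {0, w}. if z \<in> X then ?e z w else ?e z 0)" using one[of 0 w] wn by simp
        also have "\<dots> \<le> cut_size ?V ?e X"
          using cut_common_neighbours[OF e XV X(2), of w] w wn by simp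
        finally show ?thesis by simp
      qed
    qed
  qed
  then have "edge_connected (2 * k) n A" unfolding edge_connected_iff_econn .
  moreover have "2 \<le> t" if t: "sinv_digraph k n A \<le> enat t" for t
  proof (rule ccontr)
    assume "\<not> 2 \<le> t"
    obtain Xs where Xs: "length Xs \<le> t" "k_arc_strong k n (Inv A Xs)" using sinv_digraph_leE[OF t] .
    define c where "c u v = odd (joint_count Xs u v)" for u v
    have R: "k_arc_strong k n (reorient c A)" using Xs(2) unfolding Inv_eq_reorient c_def .
    have split: "c 0 w \<noteq> c 1 w" if "w \<in> {2,3,4}" for w
      using that U n k by (intro sink_with_two_sources_splits[OF R, of w U]) (auto simp: A_iff U_def)
    have "Xs \<noteq> []"
      using split[of 2] unfolding c_def joint_count_def by auto
    moreover have "length Xs \<le> 1" using Xs(1) \<open>\<not> 2 \<le> t\<close> by simp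
    ultimately obtain X where "Xs = [X]" by (cases Xs) auto
    then have c: "c u v \<longleftrightarrow> u \<in> X \<and> v \<in> X" for u v unfolding c_def joint_count_def by simp
    \<comment> \<open>A source outside the single inverted set keeps its outgoing arcs, so its
      in-neighbours are among the \<open>k - 1\<close> vertices of \<open>U\<close>.\<close>
    obtain h where h: "h < 2" "h \<notin> X"
    proof (cases "0 \<in> X")
      case True
      then have "1 \<notin> X" using split[of 2] unfolding c by auto
      then show thesis using that[of 1] by simp
    next
      case False
      then show thesis using that[of 0] by simp
    qed
    have "v \<in> U" if "(v, h) \<in> reorient c A" for v
      using that h unfolding reorient_iff c A_iff U_def by auto
    then have "k \<le> card U" using h n U by (intro k_arc_strong_in_nbrs[OF R, of h]) auto
    then show False using U k by simp
  qed
  ultimately show ?thesis using D by blast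
qed

text \<open>The largest \<open>m\<close> with \<open>m * (m + 1) div 2 \<le> N\<close> works. Its
  successor fails, which gives \<open>N \<le> m ^ 2\<close> for \<open>m \<ge> 3\<close>; for
  \<open>m = 2\<close> it gives \<open>N \<le> 5\<close>, and 5 is excluded.\<close>

lemma ex_hub_number:
  fixes N :: nat
  assumes "3 \<le> N" "N \<noteq> 5"
  shows "\<exists>m\<ge>2. m + (\<Sum>j<m. j) \<le> N \<and> N \<le> m ^ 2"
proof -
  define T where "T m = m + (\<Sum>j<m. j)" for m :: nat
  have T2: "2 * T m = m * (m + 1)" for m
    unfolding T_def by (induction m) auto
  have T_bound: "m \<le> N" if "T m \<le> N" for m using that unfolding T_def by simp
  have "T 2 \<le> N" using T2[of 2] assms by simp
  then obtain m where m: "T m \<le> N" and greatest: "\<And>y. T y \<le> N \<Longrightarrow> y \<le> m"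
    using GreatestI_nat[of "\<lambda>m. T m \<le> N" 2 N] Greatest_le_nat[of "\<lambda>m. T m \<le> N" _ N] T_bound by blast
  have m2: "2 \<le> m" using greatest[OF \<open>T 2 \<le> N\<close>] .
  have "\<not> T (m + 1) \<le> N" using greatest[of "m + 1"] by auto
  then have up: "2 * N < (m + 1) * (m + 2)" using T2[of "m + 1"] by simp
  have "N \<le> m ^ 2"
  proof (cases "m = 2")
    case True
    then show ?thesis using up assms by simp
  next
    case False
    then have "3 * m \<le> m * m" using m2 by simp
    moreover have "2 * N < m * m + 3 * m + 2" using up by (simp add: algebra_simps)
    ultimately show ?thesis unfolding power2_eq_square by linarith
  qed
  then show ?thesis using m m2 unfolding T_def by blast
qed

text \<open>Squaring \<open>m \<le> 2 ^ t\<close> produces \<open>4 ^ t\<close>, the source of the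
  factor 1/2 before the logarithm.\<close>

lemma sinv_lower_witness:
  fixes k n :: nat
  assumes k: "1 \<le> k" and n: "k + 2 \<le> n"
  shows "\<exists>A. digraph_on n A \<and> edge_connected (2 * k) n A \<and> (\<forall>t. sinv_digraph k n A \<le> enat t \<longrightarrow> n + 1 - k \<le> 4 ^ t)"
proof (cases "n = k + 4")
  case True
  obtain A where A: "digraph_on n A" "edge_connected (2 * k) n A" "\<And>t. sinv_digraph k n A \<le> enat t \<Longrightarrow> 2 \<le> t"
    using ex_digraph_five[OF k True] by blast
  have "n + 1 - k \<le> 4 ^ t" if "sinv_digraph k n A \<le> enat t" for t
  proof -
    have "(4::nat) ^ 2 \<le> 4 ^ t" using A(3)[OF that] by (intro power_increasing) auto
    then show ?thesis using True by simp
  qed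
  then show ?thesis using A by blast
next
  case False
  have "3 \<le> n + 1 - k" "n + 1 - k \<noteq> 5" using n False by linarith+
  then obtain m where m: "2 \<le> m" "m + (\<Sum>j<m. j) \<le> n + 1 - k" "n + 1 - k \<le> m ^ 2"
    using ex_hub_number[of "n + 1 - k"] by blast
  have "m + (\<Sum>j<m. j) + (k - 1) \<le> n" using m(2) n k by linarith
  from ex_digraph_with_hubs[OF k m(1) this]
  obtain A where A: "digraph_on n A" "edge_connected (2 * k) n A" "\<And>t. sinv_digraph k n A \<le> enat t \<Longrightarrow> m \<le> 2 ^ t"
    by blast
  have "n + 1 - k \<le> 4 ^ t" if "sinv_digraph k n A \<le> enat t" for t
  proof -
    have "m ^ 2 \<le> (2 ^ t) ^ 2" using A(3)[OF that] by (rule power_mono) simp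
    also have "\<dots> = 4 ^ t" by (simp add: power_mult[symmetric] mult.commute[of t] power_mult)
    finally show ?thesis using m(3) by simp
  qed
  then show ?thesis using A by blast
qed

theorem theorem1p1:
  fixes k n :: nat
  assumes "k \<ge> 1" and "n \<ge> k + 2"
  shows "\<exists>m :: nat. sinv_order k n = enat m \<and>
           (1/2) * log 2 (real n - real k + 1) \<le> real m \<and>
           real m \<le> log 2 (real n) + 4 * real k - 3"
proof -
  obtain t where t: "\<And>A. digraph_on n A \<Longrightarrow> edge_connected (2 * k) n A \<Longrightarrow> sinv_digraph k n A \<le> enat t"
    and t_le: "real t \<le> log 2 (real n) + 4 * real k - 3"
  proof (cases "n = 3")
    case True
    \<comment> \<open>The general bound needs \<open>2 \<le> s\<close>, which fails here; two
      inversions suffice, and \<open>2 \<le> log 2 3 + 1\<close>.\<close>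
    then have "k = 1" using assms by simp
    have "1 \<le> log 2 (3::real)" by simp
    then show thesis using that[of 2] sinv_digraph_upper_three True \<open>k = 1\<close> by simp
  next
    case False
    then have "4 \<le> n" using assms by simp
    then obtain s where s: "2 ^ s \<le> n" "n < 2 ^ (s + 1)" using ex_power_ivl1[of 2 n] by auto
    have "(2::nat) ^ 2 < 2 ^ (s + 1)" using s \<open>4 \<le> n\<close> by simp
    then have "2 < s + 1" by (simp only: power_strict_increasing_iff)
    have "real s \<le> log 2 (real n)" using le_log2_of_power[OF s(1)] .
    then have "real (s + 4 * k - 3) \<le> log 2 (real n) + 4 * real k - 3"
      using assms(1) by (simp add: of_nat_diff)
    moreover have "sinv_digraph k n A \<le> enat (s + 4 * k - 3)"
      if "digraph_on n A" "edge_connected (2 * k) n A" for A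
      using sinv_digraph_upper[of n A k s] that s \<open>2 < s + 1\<close> assms by simp
    ultimately show thesis using that by blast
  qed
  \<comment> \<open>The upper bound also makes the supremum finite, hence a natural number
    \<open>m\<close>.\<close>
  have "sinv_order k n \<le> enat t"
    unfolding sinv_order_def using t by (intro Sup_least) auto
  then obtain m where m: "sinv_order k n = enat m" "m \<le> t"
    by (cases "sinv_order k n") auto
  obtain A where A: "digraph_on n A" "edge_connected (2 * k) n A"
    "\<And>t. sinv_digraph k n A \<le> enat t \<Longrightarrow> n + 1 - k \<le> 4 ^ t"
    using sinv_lower_witness[OF assms] by blast
  have "sinv_digraph k n A \<le> sinv_order k n"
    unfolding sinv_order_def using A(1,2) by (intro Sup_upper) blast
  then have "n + 1 - k \<le> 4 ^ m" using A(3)[of m] m(1) by simp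
  then have "real (n + 1 - k) \<le> real (4 ^ m)" by (simp only: of_nat_le_iff)
  then have le: "real n - real k + 1 \<le> 4 ^ m" using assms by (simp add: of_nat_diff)
  have "log 2 (real n - real k + 1) \<le> log 2 (4 ^ m)"
    using le assms by (intro log_mono) auto
  also have "log 2 (4 ^ m) = 2 * real m"
  proof -
    have "(4::real) ^ m = 2 ^ (2 * m)" by (simp add: power_mult)
    then show ?thesis by (simp add: log_nat_power)
  qed
  finally have "(1/2) * log 2 (real n - real k + 1) \<le> real m" by simp
  moreover have "real m \<le> log 2 (real n) + 4 * real k - 3" using m(2) t_le by linarith
  ultimately show ?thesis using m(1) by blast
qed

end
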